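(* Let $s\in\mathbb C$ with $\mathrm{Re}\,s<0$, $w=e^s$, and $$\varphi^{P}(z)=\sum_{k\ge0}\frac{w^k}{z+k},\qquad \tilde\varphi^{P}(z)=\sum_{n\ge0}(-1)^nb_nz^{-n-1},\quad b_n=\sum_{k\ge0}k^nw^k .$$ Let $\hat\varphi^P=\mathcal B\tilde\varphi^P$, that is, the Taylor series at $0$ of $\frac{1}{1-e^{s-\zeta}}$. (1) The formal series $\tilde\varphi^P$ is $1$-summable in the directions of $I=(-\frac\pi2,\frac\pi2)$ and fine-summable in the directions $\pm\frac\pi2$, with $\hat\varphi^P\in\mathcal N(I,0)\cap\mathcal N_0(\mathrm i\mathbb R^+)\cap\mathcal N_0(-\mathrm i\mathbb R^+)$. Its Borel sum $\mathcal S^I\tilde\varphi^P$ coincides with the function $\varphi^P$ in $\mathcal D(I,0)=\mathbb C\setminus\mathbb R^-$. (2) Let $\omega_k=s-2\pi\mathrm i k$ for $k\in\mathbb Z$. Then, for each $k\in\mathbb Z$, $\tilde\varphi^P$ is $1$-summable in the directions of $J_k=(\arg\omega_k,\arg\omega_{k+1})\subset(\frac\pi2,\frac{3\pi}2)$, with $\hat\varphi^P\in\mathcal N(J_k,\gamma)$, $\gamma(\theta):=\cos\theta$; thus $\mathcal D(J_k,\gamma)$ is a sectorial neighbourhood of $\infty$ containing the real half-line $(-\infty,1)$. The Borel sum of $\tilde\varphi^P$ in the directions of $J_k$ is a solution of the equation $\varphi(z)-w\varphi(z+1)=z^{-1}$ which differs from $\varphi^P$ by $$\varphi^P(z)-\mathcal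 S^{J_k}\tilde\varphi^P(z)=2\pi\mathrm i\,\frac{e^{-\omega_kz}}{1-e^{-2\pi\mathrm i z}}=-2\pi\mathrm i\,\frac{e^{-\omega_{k+1}z}}{1-e^{2\pi\mathrm i z}}$$ (an identity between meromorphic functions).
   Context: $\mathbb R^+=[0,\infty)$, $\mathbb R^-=(-\infty,0]$; $\arg\omega_k$ is chosen in $(\frac\pi2,\frac{3\pi}2)$. $\varphi^P$ is meromorphic on $\mathbb C$ with simple poles at the non-positive integers. The formal Borel transform is $\mathcal B(\sum_{n\ge0}a_nz^{-n-1})=\sum a_n\frac{\zeta^n}{n!}$. For $\theta\in\mathbb R$ and $c\in\mathbb R$, $\mathcal N_c(e^{\mathrm i\theta}\mathbb R^+)$ is the set of $\hat\varphi\in\mathbb C\{\zeta\}$ extending analytically to $\{\zeta\mid\mathrm{dist}(\zeta,e^{\mathrm i\theta}\mathbb R^+)<\delta\}$ for some $\delta>0$ with $|\hat\varphi(\zeta)|\le A e^{c|\zeta|}$ there for some $A>0$; $\tilde\varphi\in z^{-1}\mathbb C[[z^{-1}]]$ is fine-summable in the direction $\theta$ if $\mathcal B\tilde\varphi\in\bigcup_c\mathcal N_c(e^{\mathrm i\theta}\mathbb R^+)$. For an open interval $I$ and locally bounded $\gamma:I\to\mathbb R$, $\mathcal N(I,\gamma)$ is the set of $\hat\varphi\in\mathbb C\{\zeta\}$ extending analytically to $\{\xi e^{\mathrm i\theta}\mid\xi>0,\theta\in I\}$ with $|\hat\varphi(\xi e^{\mathrm i\theta})|\le\alpha(\theta)e^{\gamma(\theta)\xi}$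 for some locally bounded $\alpha:I\to\mathbb R^+$; $\tilde\varphi$ is $1$-summable in the directions of $I$ if $\mathcal B\tilde\varphi\in\mathcal N(I,\gamma)$ for some $\gamma$. For $|I|\le\pi$, $\mathcal D(I,\gamma)=\bigcup_{\theta\in I}\Pi^\theta_{\gamma(\theta)}$ with $\Pi^\theta_c=\{\mathrm{Re}(ze^{\mathrm i\theta})>c\}$, and $\mathcal S^I\tilde\varphi(z)=\int_0^{+\infty}e^{-z\xi e^{\mathrm i\theta}}\hat\varphi(\xi e^{\mathrm i\theta})e^{\mathrm i\theta}d\xi$ for any $\theta\in I$ with $z\in\Pi^\theta_{\gamma(\theta)}$ (independent of the choice of $\theta$). $\mathcal D(I,\gamma)$ is a sectorial neighbourhood of $\infty$ in the sense that, with $\theta^*$ the midpoint of $I$, for every $\varepsilon>0$ it contains a sector bisected by a half-line of direction $-\theta^*$ with opening $\pi+|I|-\varepsilon$. *)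

theory Defs
  imports "HOL-Complex_Analysis.Complex_Analysis"
begin

section \<open>Formal series in \<open>1/z\<close> and the formal Borel transform\<close>

text \<open>
  A formal series in \<open>\<complex>[[1/z]]\<close> is a formal power series whose indeterminate stands for \<open>1/z\<close>,
  so \<open>f $ Suc n\<close> is the coefficient of \<open>z^(-n-1)\<close>, and membership in \<open>(1/z) \<complex>[[1/z]]\<close> is
  \<open>f $ 0 = 0\<close>.
\<close>

definition formal_borel :: "complex fps \<Rightarrow> complex fps" where
  "formal_borel f = Abs_fps (\<lambda>n. f $ Suc n / fact n)"

section \<open>Summability\<close>

text \<open>
  The germ at 0 given by a convergent power series \<open>\<phi>\<close> extends to \<open>U\<close> as \<open>g\<close>. The domains \<open>U\<close> used
  below are strips around a half-line issued from 0 (which contain 0) and sectors with vertex 0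
  (which do not), so agreement is required on the part of \<open>U\<close> lying in some disc around 0.
\<close>
definition analytic_extension :: "complex fps \<Rightarrow> complex set \<Rightarrow> (complex \<Rightarrow> complex) \<Rightarrow> bool" where
  "analytic_extension \<phi> U g \<longleftrightarrow>
     fps_conv_radius \<phi> > 0 \<and> g holomorphic_on U \<and>
     (\<exists>r>0. \<forall>\<zeta>\<in>U \<inter> ball 0 r. g \<zeta> = eval_fps \<phi> \<zeta>)"

definition strip :: "real \<Rightarrow> real \<Rightarrow> complex set" where
  "strip \<theta> \<delta> = {\<zeta>. infdist \<zeta> {of_real t * cis \<theta> | t. t \<ge> 0} < \<delta>}"

definition N_ray :: "real \<Rightarrow> real \<Rightarrow> complex fps set" where
  "N_ray c \<theta> = {\<phi>. \<exists>\<delta>>0. \<exists>A>0. \<exists>g. analytic_extension \<phi> (strip \<theta> \<delta>) g \<and>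
                   (\<forall>\<zeta>\<in>strip \<theta> \<delta>. norm (g \<zeta>) \<le> A * exp (c * norm \<zeta>))}"

definition fine_summable :: "real \<Rightarrow> complex fps \<Rightarrow> bool" where
  "fine_summable \<theta> f \<longleftrightarrow> f $ 0 = 0 \<and> formal_borel f \<in> (\<Union>c. N_ray c \<theta>)"

definition locally_bounded_on :: "real set \<Rightarrow> (real \<Rightarrow> real) \<Rightarrow> bool" where
  "locally_bounded_on I \<gamma> \<longleftrightarrow> (\<forall>\<theta>\<in>I. \<exists>e>0. bounded (\<gamma> ` (I \<inter> ball \<theta> e)))"

definition open_sector :: "real set \<Rightarrow> complex set" where
  "open_sector I = {of_real \<xi> * cis \<theta> | \<xi> \<theta>. \<xi> > 0 \<and> \<theta> \<in> I}"

definition N_sector :: "real set \<Rightarrow> (real \<Rightarrow> real) \<Rightarrow> complex fps set" where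
  "N_sector I \<gamma> = {\<phi>. \<exists>g \<alpha>. analytic_extension \<phi> (open_sector I) g \<and>
      locally_bounded_on I \<alpha> \<and> (\<forall>\<theta>\<in>I. 0 \<le> \<alpha> \<theta>) \<and>
      (\<forall>\<theta>\<in>I. \<forall>\<xi>>0. norm (g (of_real \<xi> * cis \<theta>)) \<le> \<alpha> \<theta> * exp (\<gamma> \<theta> * \<xi>))}"

definition one_summable :: "real set \<Rightarrow> complex fps \<Rightarrow> bool" where
  "one_summable I f \<longleftrightarrow> f $ 0 = 0 \<and>
     (\<exists>\<gamma>. locally_bounded_on I \<gamma> \<and> formal_borel f \<in> N_sector I \<gamma>)"

section \<open>Borel sums\<close>

definition half_plane :: "real \<Rightarrow> real \<Rightarrow> complex set" where
  "half_plane \<theta> c = {z. Re (z * cis \<theta>) > c}"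

definition borel_domain :: "real set \<Rightarrow> (real \<Rightarrow> real) \<Rightarrow> complex set" where
  "borel_domain I \<gamma> = (\<Union>\<theta>\<in>I. half_plane \<theta> (\<gamma> \<theta>))"

text \<open>On the connected set \<open>open_sector I\<close> the extension is unique; off it the choice is irrelevant.\<close>
definition borel_continuation :: "real set \<Rightarrow> complex fps \<Rightarrow> complex \<Rightarrow> complex" where
  "borel_continuation I f = (SOME g. analytic_extension (formal_borel f) (open_sector I) g)"

text \<open>
  The value is the common value of all the (convergent) Laplace integrals along the admissible
  directions \<open>\<theta>\<close>. It is meaningful only for \<open>z \<in> borel_domain I \<gamma>\<close>.
\<close>
definition borel_sum :: "real set \<Rightarrow> (real \<Rightarrow> real) \<Rightarrow> complex fps \<Rightarrow> complex \<Rightarrow> complex" where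
  "borel_sum I \<gamma> f z = (THE v. \<forall>\<theta>\<in>I. z \<in> half_plane \<theta> (\<gamma> \<theta>) \<longrightarrow>
     ((\<lambda>\<xi>. exp (- z * of_real \<xi> * cis \<theta>) *
            borel_continuation I f (of_real \<xi> * cis \<theta>) * cis \<theta>) has_integral v) {0..})"

definition sector_at :: "complex \<Rightarrow> real \<Rightarrow> real \<Rightarrow> complex set" where
  "sector_at z0 dir opening =
     {z0 + of_real r * cis (dir + t) | r t. r > 0 \<and> \<bar>t\<bar> < opening / 2}"

text \<open>
  Sectorial neighbourhood of infinity attached to the interval \<open>(a, b)\<close>, of midpoint \<open>(a + b) / 2\<close>
  and length \<open>b - a\<close>. The vertex of the sector is free and may depend on \<open>\<epsilon>\<close>.
\<close>
definition sectorial_nbhd_infinity :: "real \<Rightarrow> real \<Rightarrow> complex set \<Rightarrow> bool" where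
  "sectorial_nbhd_infinity a b D \<longleftrightarrow>
     (\<forall>\<epsilon>>0. \<exists>z0. sector_at z0 (- ((a + b) / 2)) (pi + (b - a) - \<epsilon>) \<subseteq> D)"

section \<open>The Poincare series\<close>

text \<open>At the poles \<open>z = 0, -1, -2, \<dots>\<close> the value is a meaningless finite number.\<close>
definition phiP :: "complex \<Rightarrow> complex \<Rightarrow> complex" where
  "phiP w z = (\<Sum>k. w ^ k / (z + of_nat k))"

text \<open>Note that \<open>0 ^ 0 = 1\<close>, so that \<open>coeff_b w 0\<close> is the full geometric series.\<close>
definition coeff_b :: "complex \<Rightarrow> nat \<Rightarrow> complex" where
  "coeff_b w n = (\<Sum>k. of_nat k ^ n * w ^ k)"

definition phiP_formal :: "complex \<Rightarrow> complex fps" where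
  "phiP_formal w = Abs_fps (\<lambda>m. case m of 0 \<Rightarrow> 0 | Suc n \<Rightarrow> (- 1) ^ n * coeff_b w n)"

definition omega :: "complex \<Rightarrow> int \<Rightarrow> complex" where
  "omega s k = s - 2 * of_real pi * \<i> * of_int k"

text \<open>
  For \<open>Re s < 0\<close> the point \<open>omega s k\<close> lies in the open left half-plane, so that the
  determination of the argument in \<open>[0, 2\<pi>)\<close> is the one in \<open>(\<pi>/2, 3\<pi>/2)\<close>.
\<close>
definition arg_omega :: "complex \<Rightarrow> int \<Rightarrow> real" where
  "arg_omega s k = Arg2pi (omega s k)"

definition J :: "complex \<Rightarrow> int \<Rightarrow> real set" where
  "J s k = {arg_omega s k <..< arg_omega s (k + 1)}"

end

theory Submission
  imports Defs
begin

text \<open>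
  Write \<open>\<phi>\<close> for the function \<open>1 / (1 - exp (s - t))\<close>. Right of its line of poles, a primitive of
  \<open>- exp (- z t) \<phi> t\<close> is \<open>A t = exp (- z t) phiP (exp (s - t)) z\<close>, and a Laplace integral in a direction of
  the right half-plane is \<open>A 0 = phiP (exp s) z\<close>. Left of that line, the reflected series gives
  a primitive \<open>L\<close>, which tends to 0 along the rays of \<open>J s k\<close>. Such a ray passes between two consecutive
  poles, so its Laplace integral is \<open>phiP (exp s) z\<close> minus a connection constant comparing \<open>A\<close>
  and \<open>L\<close> across the gap. Translating the gap by \<open>2 \<pi> i\<close> multiplies the constant by \<open>exp (- 2 \<pi> i z)\<close> and
  moves it across exactly one pole, whose residue therefore determines it.
\<close>

section \<open>The Poincare series and its Borel transform\<close>

text \<open>The obstacle is the line \<open>Re t = Re s\<close>: neither series can be relied on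
  there, while every ray of \<open>J s k\<close> has to cross it. So one primitive on the whole gap
  must exist before the two series are used, and they only identify it on either side. The
  reflection rests on \<open>phi_hat s t = - exp (t - s) * phi_hat (- s) (- t)\<close>: its factor
  \<open>exp t\<close> replaces \<open>z\<close> by \<open>1 - z\<close> and is also the source of
  the growth exponent \<open>cos \<theta>\<close>, hence of half-planes bounded by lines through 1.
  The poles of \<open>phiP v\<close> are non-positive integers, those of the reflected series are
  positive ones, and the connection constant divides by
  \<open>1 - exp (- 2 * of_real pi * \<i> * z)\<close>. The computation is therefore done for
  non-integral \<open>z\<close>; integral points are recovered by continuity of the Laplace
  integral.\<close>

text \<open>The Euler operator \<open>v * d/dv\<close> multiplies the n-th coefficient by
  \<open>n\<close>. It raises the exponent in \<open>coeff_b\<close> and yields a differential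
  equation for \<open>phiP\<close> in its first argument. Keeping \<open>D\<close> existential
  avoids a division by \<open>v\<close> at \<open>v = 0\<close>.\<close>

lemma power_series_euler:
  fixes c :: "nat \<Rightarrow> complex"
  assumes c: "\<And>x. norm x < 1 \<Longrightarrow> summable (\<lambda>n. c n * x ^ n)" and v: "norm v < 1"
  shows "summable (\<lambda>n. of_nat n * c n * v ^ n)"
    and "\<exists>D. ((\<lambda>x. \<Sum>n. c n * x ^ n) has_field_derivative D) (at v) \<and>
           v * D = (\<Sum>n. of_nat n * c n * v ^ n)"
proof -
  have "summable (\<lambda>n. diffs c n * v ^ n)"
    using termdiff_converges[of v 1 c] c v by simp
  then have "(\<lambda>n. of_nat n * c n * v ^ (n - Suc 0)) sums (\<Sum>n. diffs c n * v ^ n)"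
    by (rule diffs_equiv)
  from sums_mult[OF this, of v]
  have *: "(\<lambda>n. of_nat n * c n * v ^ n) sums (v * (\<Sum>n. diffs c n * v ^ n))"
  proof (rule sums_cong[THEN iffD1, rotated])
    fix n show "v * (of_nat n * c n * v ^ (n - Suc 0)) = of_nat n * c n * v ^ n"
      by (cases n) auto
  qed
  then show "summable (\<lambda>n. of_nat n * c n * v ^ n)" by (rule sums_summable)
  have "((\<lambda>x. \<Sum>n. c n * x ^ n) has_field_derivative (\<Sum>n. diffs c n * v ^ n)) (at v)"
    by (rule termdiffs_strong'[where K = 1]) (use c v in auto)
  with * show "\<exists>D. ((\<lambda>x. \<Sum>n. c n * x ^ n) has_field_derivative D) (at v) \<and>
           v * D = (\<Sum>n. of_nat n * c n * v ^ n)"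
    by (auto simp: sums_iff)
qed

text \<open>Uniformity on a unit ball gives a geometric majorant at a point and locally uniformly
  near it; being only eventual, it ignores the finitely many terms with a small or vanishing
  denominator.\<close>

lemma eventually_norm_add_of_nat_ge_1:
  fixes z :: complex
  shows "\<forall>\<^sub>F n in sequentially. \<forall>y\<in>ball z 1. 1 \<le> norm (y + of_nat n)"
proof -
  have "\<forall>\<^sub>F n in sequentially. norm z + 2 \<le> real n"
    by (rule eventually_sequentiallyI[of "nat \<lceil>norm z + 2\<rceil>"]) linarith
  then show ?thesis
  proof eventually_elim
    case (elim n)
    show ?case
    proof
      fix y assume "y \<in> ball z 1"
      then have "norm (z - y) < 1" by (simp add: dist_norm)
      then have "norm y < norm z + 1"
        using norm_triangle_ineq3[of z y] by linarith
      moreover have "norm (of_nat n :: complex) \<le> norm (y + of_nat n) + norm y"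
        using norm_triangle_ineq4[of "y + of_nat n" y] by simp
      ultimately show "1 \<le> norm (y + of_nat n)" using elim by simp
    qed
  qed
qed

lemma phiP_summable:
  fixes v z :: complex
  assumes "norm v < 1"
  shows "summable (\<lambda>k. v ^ k / (z + of_nat k))"
proof (rule summable_comparison_test_ev)
  show "summable (\<lambda>k. norm v ^ k)" using assms by simp
  show "\<forall>\<^sub>F k in sequentially. norm (v ^ k / (z + of_nat k)) \<le> norm v ^ k"
    using eventually_norm_add_of_nat_ge_1[of z]
  proof eventually_elim
    case (elim k)
    then have "norm v ^ k * 1 \<le> norm v ^ k * norm (z + of_nat k)"
      by (intro mult_left_mono) auto
    moreover have "0 < norm (z + of_nat k)" using elim by (auto dest!: bspec[of _ _ z])
    ultimately show ?case
      by (simp add: norm_divide norm_power divide_simps)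
  qed
qed

text \<open>This splits off the first term of the series. It holds at the poles as well, where the
  offending term is \<open>x / 0 = 0\<close> on both sides.\<close>

lemma phiP_shift:
  assumes "norm v < 1"
  shows "phiP v z = 1 / z + v * phiP v (z + 1)"
proof -
  have "phiP v z = (\<Sum>k. v ^ Suc k / (z + of_nat (Suc k))) + 1 / z"
    unfolding phiP_def using suminf_split_head[OF phiP_summable[OF assms, of z]] by simp
  also have "(\<Sum>k. v ^ Suc k / (z + of_nat (Suc k))) = v * phiP v (z + 1)"
    unfolding phiP_def by (subst suminf_mult[symmetric, OF phiP_summable[OF assms]])
      (simp add: add.assoc)
  finally show ?thesis by simp
qed

lemma phiP_shift_of_nat:
  assumes "norm v < 1"
  shows "phiP v z = (\<Sum>k<n. v ^ k / (z + of_nat k)) + v ^ n * phiP v (z + of_nat n)"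
proof (induction n)
  case (Suc n)
  then show ?case
    by (simp add: phiP_shift[OF assms, of "z + of_nat n"] algebra_simps)
qed simp

lemma nonpos_Ints_add_of_nat_nonzero:
  assumes "z \<notin> \<int>\<^sub>\<le>\<^sub>0" shows "z + of_nat n \<noteq> (0::complex)"
proof
  assume "z + of_nat n = 0"
  then have "z = - of_nat n" by (simp add: eq_neg_iff_add_eq_0)
  with assms show False by auto
qed

text \<open>Since \<open>n / (z + n) = 1 - z / (z + n)\<close>, the Euler operator turns the series
  into a geometric series minus \<open>z\<close> times itself.\<close>

lemma phiP_deriv_arg:
  assumes z: "z \<notin> \<int>\<^sub>\<le>\<^sub>0" and v: "norm v < 1"
  shows "\<exists>D. ((\<lambda>v. phiP v z) has_field_derivative D) (at v) \<and> v * D = 1 / (1 - v) - z * phiP v z"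
proof -
  let ?c = "\<lambda>k. 1 / (z + of_nat k)"
  have s: "summable (\<lambda>n. ?c n * x ^ n)" if "norm x < 1" for x
    using phiP_summable[OF that, of z] by simp
  obtain D where D: "((\<lambda>x. \<Sum>n. ?c n * x ^ n) has_field_derivative D) (at v)"
    "v * D = (\<Sum>n. of_nat n * ?c n * v ^ n)"
    using power_series_euler(2)[OF s v] by blast
  have "of_nat n * ?c n * v ^ n = v ^ n - z * (v ^ n / (z + of_nat n))" for n
    using nonpos_Ints_add_of_nat_nonzero[OF z, of n] by (simp add: field_simps)
  then have "v * D = (\<Sum>n. v ^ n - z * (v ^ n / (z + of_nat n)))"
    using D(2) by simp
  also have "\<dots> = (\<Sum>n. v ^ n) - (\<Sum>n. z * (v ^ n / (z + of_nat n)))"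
    by (rule suminf_diff[symmetric])
      (use v phiP_summable[OF v, THEN summable_mult, of z z] in \<open>auto intro!: summable_geometric\<close>)
  also have "\<dots> = 1 / (1 - v) - z * phiP v z"
    unfolding phiP_def suminf_mult[OF phiP_summable[OF v]] using v by (simp add: suminf_geometric)
  finally show ?thesis using D(1) by (auto simp: phiP_def)
qed

lemma phiP_holomorphic:
  assumes "norm v < 1"
  shows "phiP v holomorphic_on - \<int>\<^sub>\<le>\<^sub>0"
proof -
  have op: "open (- \<int>\<^sub>\<le>\<^sub>0 :: complex set)" by (simp add: open_Compl)
  obtain g where g: "\<And>x. x \<in> - \<int>\<^sub>\<le>\<^sub>0 \<Longrightarrow>
      ((\<lambda>n. v ^ n / (x + of_nat n)) sums g x) \<and> g field_differentiable (at x)"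
  proof (rule series_differentiable_comparison_complex[OF op, where f = "\<lambda>n x. v ^ n / (x + of_nat n)"])
    fix n :: nat and x :: complex assume "x \<in> - \<int>\<^sub>\<le>\<^sub>0"
    then show "(\<lambda>x. v ^ n / (x + of_nat n)) field_differentiable at x"
      using nonpos_Ints_add_of_nat_nonzero[of x n] by (auto intro!: derivative_intros)
  next
    fix x :: complex assume "x \<in> - \<int>\<^sub>\<le>\<^sub>0"
    let ?h = "\<lambda>n. complex_of_real (norm v ^ n)"
    have "\<forall>\<^sub>F n in sequentially. \<forall>y\<in>ball x 1 \<inter> - \<int>\<^sub>\<le>\<^sub>0. norm (v ^ n / (y + of_nat n)) \<le> norm (?h n)"
      using eventually_norm_add_of_nat_ge_1[of x]
    proof eventually_elim
      case (elim n)
      show ?case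
      proof
        fix y assume "y \<in> ball x 1 \<inter> - \<int>\<^sub>\<le>\<^sub>0"
        with elim have "1 \<le> norm (y + of_nat n)" by blast
        then show "norm (v ^ n / (y + of_nat n)) \<le> norm (?h n)"
          by (simp add: norm_divide norm_power divide_simps mult_le_cancel_left1)
      qed
    qed
    moreover have "summable ?h" using assms
      by (subst summable_of_real_iff) auto
    moreover have "range ?h \<subseteq> \<real>\<^sub>\<ge>\<^sub>0" by auto
    ultimately show "\<exists>d (h :: nat \<Rightarrow> complex). 0 < d \<and> summable h \<and> range h \<subseteq> \<real>\<^sub>\<ge>\<^sub>0 \<and>
       (\<forall>\<^sub>F n in sequentially. \<forall>y\<in>ball x d \<inter> - \<int>\<^sub>\<le>\<^sub>0. norm (v ^ n / (y + of_nat n)) \<le> norm (h n))"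
      using zero_less_one by blast
  qed blast
  then have "g holomorphic_on - \<int>\<^sub>\<le>\<^sub>0"
    by (auto simp: holomorphic_on_def intro: field_differentiable_at_within)
  then show ?thesis
    by (rule holomorphic_transform) (use g in \<open>auto simp: phiP_def sums_iff\<close>)
qed

lemma phiP_analytic:
  assumes "norm v < 1" "z \<notin> \<int>\<^sub>\<le>\<^sub>0"
  shows "phiP v analytic_on {z}"
  using phiP_holomorphic[OF assms(1)] assms(2) 
  by (auto simp: analytic_at intro!: exI[of _ "- \<int>\<^sub>\<le>\<^sub>0"])

text \<open>A shift by a large \<open>n\<close> moves the given point into the right half-plane,
  where \<open>phiP v\<close> is analytic; what splits off is a finite sum of fractions.\<close>

lemma phiP_meromorphic:
  assumes "norm v < 1"
  shows "phiP v meromorphic_on A"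
proof (rule meromorphic_on_subset[OF _ subset_UNIV], subst meromorphic_on_meromorphic_at, rule ballI)
  fix z :: complex
  obtain n :: nat where n: "- Re z < real n" using reals_Archimedean2 by blast
  have "z + of_nat n \<notin> \<int>\<^sub>\<le>\<^sub>0"
    using n by (auto elim!: nonpos_Ints_cases simp: complex_eq_iff)
  then have "phiP v analytic_on (\<lambda>z. z + of_nat n) ` {z}"
    using phiP_analytic[OF assms] by simp
  then have "(\<lambda>z. phiP v (z + of_nat n)) analytic_on {z}"
    using analytic_on_compose[of "\<lambda>z. z + of_nat n" "{z}" "phiP v"]
    by (simp add: o_def analytic_on_add analytic_on_ident analytic_on_const)
  then have "(\<lambda>z. phiP v (z + of_nat n)) meromorphic_on {z}"
    by (rule analytic_on_imp_meromorphic_on)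
  then have "(\<lambda>z. (\<Sum>k<n. v ^ k / (z + of_nat k)) + v ^ n * phiP v (z + of_nat n)) meromorphic_on {z}"
    by (intro meromorphic_on_add meromorphic_on_sum meromorphic_on_divide meromorphic_on_mult
        meromorphic_on_const meromorphic_on_id)
  then show "phiP v meromorphic_on {z}"
    unfolding phiP_shift_of_nat[OF assms, of _ n, symmetric] .
qed

section \<open>The coefficients of the formal series and the Taylor expansion of the Borel
  transform\<close>

lemma coeff_b_summable:
  "norm v < 1 \<Longrightarrow> summable (\<lambda>k. of_nat k ^ n * v ^ k :: complex)"
proof (induction n arbitrary: v)
  case 0
  then show ?case by (simp add: summable_geometric)
next
  case (Suc n)
  show ?case
    using power_series_euler(1)[of "\<lambda>k. of_nat k ^ n" v, OF Suc.IH Suc.prems] by (simp add: mult.assoc)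
qed

lemma coeff_b_deriv:
  assumes "norm v < 1"
  shows "\<exists>D. ((\<lambda>v. coeff_b v n) has_field_derivative D) (at v) \<and> v * D = coeff_b v (Suc n)"
  using power_series_euler(2)[of "\<lambda>k. of_nat k ^ n" v, OF coeff_b_summable assms]
  by (simp add: coeff_b_def mult.assoc)

definition phi_hat :: "complex \<Rightarrow> complex \<Rightarrow> complex" where
  "phi_hat s \<zeta> = 1 / (1 - exp (s - \<zeta>))"

lemma exp_diff_eq_1_iff_omega: "exp (s - \<zeta>) = 1 \<longleftrightarrow> (\<exists>k. \<zeta> = omega s k)"
proof -
  have "exp (s - \<zeta>) = 1 \<longleftrightarrow> (\<exists>k::int. s - \<zeta> = of_int (2 * k) * of_real pi * \<i>)"
    by (subst exp_eq_1) (simp add: complex_eq_iff)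
  also have "\<dots> \<longleftrightarrow> (\<exists>k. \<zeta> = omega s k)"
    unfolding omega_def by (rule iff_exI) (auto simp: algebra_simps)
  finally show ?thesis .
qed

lemma phi_hat_analytic:
  assumes "\<And>\<zeta> k. \<zeta> \<in> A \<Longrightarrow> \<zeta> \<noteq> omega s k"
  shows "phi_hat s analytic_on A"
  unfolding phi_hat_def using assms exp_diff_eq_1_iff_omega[of s]
  by (auto intro!: analytic_intros simp: eq_commute[of 1])

lemma Re_omega [simp]: "Re (omega s k) = Re s"
  by (simp add: omega_def)

text \<open>In this half-plane \<open>phi_hat s\<close> is the geometric series in
  \<open>v = exp (s - \<zeta>)\<close>, and differentiation in \<open>\<zeta>\<close> is minus the
  Euler operator in \<open>v\<close>; each derivative thus raises the exponent by one and
  contributes a sign.\<close>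

lemma higher_deriv_phi_hat:
  assumes "Re s < Re \<zeta>"
  shows "(deriv ^^ n) (phi_hat s) \<zeta> = (- 1) ^ n * coeff_b (exp (s - \<zeta>)) n"
  using assms
proof (induction n arbitrary: \<zeta>)
  case 0
  then show ?case by (simp add: coeff_b_def phi_hat_def suminf_geometric)
next
  case (Suc n)
  have op: "open {\<zeta>. Re s < Re \<zeta>}" by (rule open_halfspace_Re_gt)
  have "norm (exp (s - \<zeta>)) < 1" using Suc.prems by simp
  then obtain D where D: "((\<lambda>v. coeff_b v n) has_field_derivative D) (at (exp (s - \<zeta>)))"
    "exp (s - \<zeta>) * D = coeff_b (exp (s - \<zeta>)) (Suc n)"
    using coeff_b_deriv by blast
  have "((\<lambda>\<zeta>. exp (s - \<zeta>)) has_field_derivative - exp (s - \<zeta>)) (at \<zeta>)"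
    by (auto intro!: derivative_eq_intros)
  from DERIV_chain2[OF D(1) this]
  have "((\<lambda>\<zeta>. (- 1) ^ n * coeff_b (exp (s - \<zeta>)) n) has_field_derivative
      (- 1) ^ n * (D * - exp (s - \<zeta>))) (at \<zeta>)"
    by (intro DERIV_cmult) simp
  moreover have "D * - exp (s - \<zeta>) = - coeff_b (exp (s - \<zeta>)) (Suc n)"
    using D(2) by (simp add: mult.commute)
  ultimately have "((\<lambda>\<zeta>. (- 1) ^ n * coeff_b (exp (s - \<zeta>)) n) has_field_derivative
      (- 1) ^ Suc n * coeff_b (exp (s - \<zeta>)) (Suc n)) (at \<zeta>)" by simp
  then have "((deriv ^^ n) (phi_hat s) has_field_derivative
      (- 1) ^ Suc n * coeff_b (exp (s - \<zeta>)) (Suc n)) (at \<zeta>)"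
    by (rule has_field_derivative_transform_within_open[OF _ op]) (use Suc in auto)
  then show ?case by (simp add: DERIV_imp_deriv)
qed

lemma phi_hat_has_fps_expansion:
  assumes "Re s < 0"
  shows "phi_hat s has_fps_expansion formal_borel (phiP_formal (exp s))"
proof -
  have "phi_hat s analytic_on {\<zeta>. Re s < Re \<zeta>}"
    by (rule phi_hat_analytic) auto
  then have "phi_hat s has_fps_expansion fps_expansion (phi_hat s) 0"
    by (intro has_fps_expansion_fps_expansion[of "{\<zeta>. Re s < Re \<zeta>}"])
      (use assms in \<open>auto simp: open_halfspace_Re_gt analytic_imp_holomorphic\<close>)
  also have "fps_expansion (phi_hat s) 0 = formal_borel (phiP_formal (exp s))"
    using assms by (simp add: fps_eq_iff fps_expansion_def formal_borel_def phiP_formal_def higher_deriv_phi_hat)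
  finally show ?thesis .
qed

lemma phi_hat_analytic_extension:
  assumes "Re s < 0" and U: "\<And>\<zeta> k. \<zeta> \<in> U \<Longrightarrow> \<zeta> \<noteq> omega s k"
  shows "analytic_extension (formal_borel (phiP_formal (exp s))) U (phi_hat s)"
proof -
  let ?F = "formal_borel (phiP_formal (exp s))"
  have F: "fps_conv_radius ?F > 0" "\<forall>\<^sub>F z in nhds 0. eval_fps ?F z = phi_hat s z"
    using phi_hat_has_fps_expansion[OF assms(1)] by (auto simp: has_fps_expansion_def)
  then obtain r where "r > 0" "\<And>z. dist z 0 < r \<Longrightarrow> eval_fps ?F z = phi_hat s z"
    unfolding eventually_nhds_metric by auto
  then show ?thesis
    using F(1) analytic_imp_holomorphic[OF phi_hat_analytic[OF U]]
    by (auto simp: analytic_extension_def dist_commute intro!: exI[of _ r])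
qed

section \<open>Primitives of the Laplace integrand on the two sides of the line of poles\<close>

text \<open>With \<open>v = exp (s - t)\<close> the chain rule gives minus the Euler operator; its
  term in \<open>z * phiP v z\<close> cancels against the derivative of
  \<open>exp (- z * t)\<close>.\<close>

lemma laplace_primitive_right:
  assumes "z \<notin> \<int>\<^sub>\<le>\<^sub>0" "Re s < Re t"
  shows "((\<lambda>t. exp (- z * t) * phiP (exp (s - t)) z) has_field_derivative
           - (exp (- z * t) * phi_hat s t)) (at t)"
proof -
  have n: "norm (exp (s - t)) < 1" using assms by simp
  then obtain D where D: "((\<lambda>v. phiP v z) has_field_derivative D) (at (exp (s - t)))"
    "exp (s - t) * D = 1 / (1 - exp (s - t)) - z * phiP (exp (s - t)) z"
    using phiP_deriv_arg[OF assms(1) n] by blast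
  have "((\<lambda>t. exp (s - t)) has_field_derivative - exp (s - t)) (at t)"
    by (auto intro!: derivative_eq_intros)
  from DERIV_chain2[OF D(1) this]
  have d: "((\<lambda>t. phiP (exp (s - t)) z) has_field_derivative - (exp (s - t) * D)) (at t)"
    by (simp add: mult.commute)
  have "exp (- z * t) * (exp (s - t) * D) =
      exp (- z * t) * (1 / (1 - exp (s - t)) - z * phiP (exp (s - t)) z)"
    by (simp only: D(2))
  then show ?thesis
    by - ((rule derivative_eq_intros d refl | simp)+, simp add: phi_hat_def algebra_simps)
qed

text \<open>This is the right-hand primitive at \<open>- s\<close>, \<open>- t\<close>,
  \<open>1 - z\<close>, composed with negation and scaled by \<open>exp (- s)\<close>, the constant
  part of the factor \<open>exp (t - s)\<close> relating \<open>phi_hat s t\<close> to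
  \<open>phi_hat (- s) (- t)\<close>.\<close>

lemma laplace_primitive_left:
  assumes "1 - z \<notin> \<int>\<^sub>\<le>\<^sub>0" "Re t < Re s"
  shows "((\<lambda>t. exp ((1 - z) * t - s) * phiP (exp (t - s)) (1 - z)) has_field_derivative
           - (exp (- z * t) * phi_hat s t)) (at t)"
proof -
  have "exp (t - s) \<noteq> 1" using assms(2) norm_exp_eq_Re[of "t - s"] by force
  then have "exp t \<noteq> exp s" by (simp add: exp_diff)
  have r: "((\<lambda>t. exp (- (1 - z) * t) * phiP (exp (- s - t)) (1 - z)) has_field_derivative
           - (exp (- (1 - z) * - t) * phi_hat (- s) (- t))) (at (- t))"
    using laplace_primitive_right[of "1 - z" "- s" "- t"] assms by simp
  have "((\<lambda>t. - t) has_field_derivative - 1) (at t)" by (auto intro!: derivative_eq_intros)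
  have eq: "- (1 - z) * - t = (1 - z) * t" "- s - - t = t - s" for t
    by (simp_all add: algebra_simps)
  from DERIV_cmult[OF DERIV_chain2[OF r \<open>((\<lambda>t. - t) has_field_derivative - 1) (at t)\<close>], of "exp (- s)"]
  have d: "((\<lambda>t. exp (- s) * (exp ((1 - z) * t) * phiP (exp (t - s)) (1 - z))) has_field_derivative
        exp (- s) * (exp ((1 - z) * t) * phi_hat (- s) (- t))) (at t)"
    by (simp only: eq minus_mult_minus mult_1_right)
  have "exp (- s) * (exp ((1 - z) * t) * phi_hat (- s) (- t)) = - (exp (- z * t) * phi_hat s t)"
    using \<open>exp t \<noteq> exp s\<close> unfolding phi_hat_def
    by (simp add: exp_diff exp_minus exp_add ring_distribs field_simps)
  moreover have "exp (- s) * (exp ((1 - z) * t) * phiP (exp (t - s)) (1 - z)) =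
      exp ((1 - z) * t - s) * phiP (exp (t - s)) (1 - z)" for t
    by (simp add: exp_diff exp_minus exp_add field_simps)
  ultimately show ?thesis using d by (simp only:)
qed

section \<open>Laplace integrals evaluated by a primitive\<close>

lemma has_integral_halfline:
  fixes f P :: "real \<Rightarrow> complex"
  assumes P: "\<And>x. x \<ge> 0 \<Longrightarrow> (P has_vector_derivative f x) (at x)"
    and bound: "\<And>x. x \<ge> 0 \<Longrightarrow> norm (f x) \<le> C * exp (- \<epsilon> * x)" and "\<epsilon> > 0"
    and lim: "(P \<longlongrightarrow> l) at_top"
  shows "(f has_integral (l - P 0)) {0..}"
proof -
  define F where "F = (\<lambda>(k::nat) x. if x \<in> {0..real k} then f x else 0)"
  have I: "(F k has_integral (P k - P 0)) {0..}" for k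
  proof -
    have "(f has_integral (P k - P 0)) {0..real k}"
      by (rule fundamental_theorem_of_calculus) (auto intro: has_vector_derivative_at_within P)
    then show ?thesis
      unfolding F_def by (subst has_integral_restrict) auto
  qed
  have h: "(\<lambda>x. C * exp (- \<epsilon> * x)) integrable_on {0..}"
    using integrable_on_cmult_left[OF integrable_on_exp_minus_to_infinity[OF \<open>\<epsilon> > 0\<close>, of 0], of C] by simp
  \<comment> \<open>Where the truncation is 0 the majorant must be non-negative, which follows from
    its bounding a norm.\<close>
  have le: "norm (F k x) \<le> C * exp (- \<epsilon> * x)" if "x \<in> {0..}" for k x
    using bound[of x] order_trans[OF norm_ge_zero bound, of x] that by (auto simp: F_def)
  have conv: "(\<lambda>k. F k x) \<longlonglongrightarrow> f x" if "x \<in> {0..}" for x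
  proof (rule tendsto_eventually)
    show "\<forall>\<^sub>F k in sequentially. F k x = f x"
      by (rule eventually_sequentiallyI[of "nat \<lceil>x\<rceil>"]) (use that in \<open>auto simp: F_def; linarith\<close>)
  qed
  have int: "F k integrable_on {0..}" for k using I by blast
  note dc = dominated_convergence[OF int h le conv]
  have "(\<lambda>k. P (real k) - P 0) \<longlonglongrightarrow> l - P 0"
    by (intro tendsto_intros filterlim_compose[OF lim filterlim_real_sequentially])
  moreover have "(\<lambda>k. P (real k) - P 0) \<longlonglongrightarrow> integral {0..} f"
    using dc(2) integral_unique[OF I] by simp
  ultimately have "integral {0..} f = l - P 0" by (rule LIMSEQ_unique[symmetric])
  with dc(1) show ?thesis by (metis integrable_integral)
qed

lemma tendsto_exp_minus_mult_at_top:
  fixes a c :: real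
  assumes "a > 0"
  shows "((\<lambda>x. exp (- a * x) * c) \<longlongrightarrow> 0) at_top"
  by (intro tendsto_mult_left_zero filterlim_compose[OF exp_at_bot]
      filterlim_tendsto_neg_mult_at_bot[OF tendsto_const])
    (use assms in \<open>auto simp: filterlim_ident\<close>)

lemma norm_exp_mult_cis:
  "norm (exp (- z * of_real \<xi> * cis \<theta>)) = exp (- Re (z * cis \<theta>) * \<xi>)"
  by (simp add: algebra_simps)

text \<open>The integrand decays at the rate \<open>Re (z * cis \<theta>) - \<gamma>\<close>,
  positive exactly on the half-plane; the factor \<open>cis \<theta>\<close> is the derivative of
  the parametrisation of the ray.\<close>

lemma has_integral_laplace:
  fixes g P :: "complex \<Rightarrow> complex"
  assumes P: "\<And>\<xi>. \<xi> \<ge> 0 \<Longrightarrow>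
      (P has_field_derivative exp (- z * (of_real \<xi> * cis \<theta>)) * g (of_real \<xi> * cis \<theta>)) (at (of_real \<xi> * cis \<theta>))"
    and g: "\<And>\<xi>. \<xi> \<ge> 0 \<Longrightarrow> norm (g (of_real \<xi> * cis \<theta>)) \<le> C * exp (\<gamma> * \<xi>)"
    and z: "z \<in> half_plane \<theta> \<gamma>"
    and lim: "((\<lambda>\<xi>. P (of_real \<xi> * cis \<theta>)) \<longlongrightarrow> l) at_top"
  shows "((\<lambda>\<xi>. exp (- z * of_real \<xi> * cis \<theta>) * g (of_real \<xi> * cis \<theta>) * cis \<theta>) has_integral (l - P 0)) {0..}"
proof -
  have "((\<lambda>\<xi>. exp (- z * of_real \<xi> * cis \<theta>) * g (of_real \<xi> * cis \<theta>) * cis \<theta>) has_integral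
      (l - P (of_real 0 * cis \<theta>))) {0..}"
  proof (rule has_integral_halfline[OF _ _ _ lim])
    fix \<xi> :: real assume "\<xi> \<ge> 0"
    have "((\<lambda>\<xi>. of_real \<xi> * cis \<theta>) has_vector_derivative cis \<theta>) (at \<xi>)"
      by (rule derivative_eq_intros refl | simp)+
    from field_vector_diff_chain_at[OF this P[OF \<open>\<xi> \<ge> 0\<close>]]
    show "((\<lambda>\<xi>. P (of_real \<xi> * cis \<theta>)) has_vector_derivative
        exp (- z * of_real \<xi> * cis \<theta>) * g (of_real \<xi> * cis \<theta>) * cis \<theta>) (at \<xi>)"
      by (simp add: o_def mult_ac)
    have "norm (exp (- z * of_real \<xi> * cis \<theta>) * g (of_real \<xi> * cis \<theta>) * cis \<theta>)
        = exp (- Re (z * cis \<theta>) * \<xi>) * norm (g (of_real \<xi> * cis \<theta>))"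
      by (simp only: norm_mult norm_exp_mult_cis norm_cis mult_1_right)
    also have "\<dots> \<le> exp (- Re (z * cis \<theta>) * \<xi>) * (C * exp (\<gamma> * \<xi>))"
      using g[OF \<open>\<xi> \<ge> 0\<close>] by (rule mult_left_mono) simp
    also have "\<dots> = C * exp (- (Re (z * cis \<theta>) - \<gamma>) * \<xi>)"
      by (simp add: exp_add[symmetric] algebra_simps)
    finally show "norm (exp (- z * of_real \<xi> * cis \<theta>) * g (of_real \<xi> * cis \<theta>) * cis \<theta>)
        \<le> C * exp (- (Re (z * cis \<theta>) - \<gamma>) * \<xi>)" .
  next
    show "Re (z * cis \<theta>) - \<gamma> > 0" using z by (simp add: half_plane_def)
  qed
  then show ?thesis by simp
qed

section \<open>Sectors and the Borel sum in the right half-plane\<close>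

lemma open_sectorI: "\<xi> > 0 \<Longrightarrow> \<theta> \<in> I \<Longrightarrow> of_real \<xi> * cis \<theta> \<in> open_sector I"
  unfolding open_sector_def by blast

text \<open>A sector of opening at most \<open>pi\<close> is an intersection of two half-planes,
  which makes its openness and convexity immediate.\<close>

lemma open_sector_eq:
  assumes "a < b" "b - a \<le> pi"
  shows "open_sector {a<..<b} = {z. 0 < Im (z * cis (- a)) \<and> Im (z * cis (- b)) < 0}"
proof (intro Set.equalityI subsetI)
  fix z assume "z \<in> open_sector {a<..<b}"
  then obtain \<xi> \<phi> where z: "z = of_real \<xi> * cis \<phi>" "\<xi> > 0" "a < \<phi>" "\<phi> < b"
    by (auto simp: open_sector_def)
  then have "0 < sin (\<phi> - a)" "0 < sin (b - \<phi>)"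
    using assms by (auto intro!: sin_gt_zero)
  with z show "z \<in> {z. 0 < Im (z * cis (- a)) \<and> Im (z * cis (- b)) < 0}"
    by (simp add: mult.assoc cis_mult sin_diff algebra_simps)
next
  fix z assume "z \<in> {z. 0 < Im (z * cis (- a)) \<and> Im (z * cis (- b)) < 0}"
  then have z: "0 < Im (z * cis (- a))" "Im (z * cis (- b)) < 0" by auto
  define t where "t = Arg (z * cis (- a))"
  have "0 < t" "t < pi" using z(1) Arg_lt_pi[of "z * cis (- a)"] by (auto simp: t_def)
  have "z \<noteq> 0" using z(1) by auto
  have "z * cis (- a) = of_real (norm z) * cis t"
    using Arg_eq[of "z * cis (- a)"] \<open>z \<noteq> 0\<close> by (simp add: t_def norm_mult cis_conv_exp)
  then have "z * cis (- a) * cis a = of_real (norm z) * cis t * cis a" by simp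
  then have eq: "z = of_real (norm z) * cis (a + t)"
    by (simp add: mult.assoc cis_mult add.commute)
  then have "z * cis (- b) = of_real (norm z) * cis (a + t - b)"
    by (metis cis_mult mult.assoc uminus_add_conv_diff add.commute)
  with z(2) have "norm z * sin (a + t - b) < 0" by simp
  then have "sin (a + t - b) < 0" using \<open>z \<noteq> 0\<close> by (simp add: mult_less_0_iff)
  \<comment> \<open>Otherwise \<open>a + t - b\<close> would lie in \<open>[0, pi)\<close>, where
    the sine is non-negative.\<close>
  then have "a + t < b"
    using sin_ge_zero[of "a + t - b"] \<open>t < pi\<close> assms by linarith
  with eq \<open>0 < t\<close> \<open>z \<noteq> 0\<close> show "z \<in> open_sector {a<..<b}"
    unfolding open_sector_def by (intro CollectI exI[of _ "norm z"] exI[of _ "a + t"]) auto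
qed

lemma open_sector_open:
  assumes "a < b" "b - a \<le> pi"
  shows "open (open_sector {a<..<b})"
  unfolding open_sector_eq[OF assms]
  by (intro open_Collect_conj open_Collect_less continuous_intros)

lemma open_sector_convex:
  assumes "a < b" "b - a \<le> pi"
  shows "convex (open_sector {a<..<b})"
proof -
  have "linear (\<lambda>z::complex. z * c)" for c by (rule bounded_linear.linear[OF bounded_linear_mult_left])
  then have "convex ((\<lambda>z. z * cis (- a)) -` {z. Im z > 0} \<inter> (\<lambda>z. z * cis (- b)) -` {z. Im z < 0})"
    by (intro convex_Int convex_linear_vimage convex_halfspace_Im_gt convex_halfspace_Im_lt)
  then show ?thesis
    unfolding open_sector_eq[OF assms] by (simp add: vimage_def Collect_conj_eq)
qed

section \<open>Uniqueness of the continuation and evaluation of Borel sums\<close>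

lemma analytic_extension_unique:
  assumes ab: "a < b" "b - a \<le> pi"
    and g: "analytic_extension F (open_sector {a<..<b}) g"
    and h: "analytic_extension F (open_sector {a<..<b}) h"
    and x: "x \<in> open_sector {a<..<b}"
  shows "g x = h x"
proof -
  let ?U = "open_sector {a<..<b}"
  obtain r1 where r1: "r1 > 0" "\<And>\<zeta>. \<zeta> \<in> ?U \<inter> ball 0 r1 \<Longrightarrow> g \<zeta> = eval_fps F \<zeta>"
    using g by (auto simp: analytic_extension_def)
  obtain r2 where r2: "r2 > 0" "\<And>\<zeta>. \<zeta> \<in> ?U \<inter> ball 0 r2 \<Longrightarrow> h \<zeta> = eval_fps F \<zeta>"
    using h by (auto simp: analytic_extension_def)
  define r where "r = min r1 r2"
  have "r > 0" using r1(1) r2(1) by (simp add: r_def)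
  have "of_real (r / 2) * cis ((a + b) / 2) \<in> ?U"
    using ab(1) \<open>r > 0\<close> by (intro open_sectorI) auto
  moreover have "of_real (r / 2) * cis ((a + b) / 2) \<in> ball 0 r"
    using \<open>r > 0\<close> by (simp add: norm_mult)
  ultimately have ne: "?U \<inter> ball 0 r \<noteq> {}" by blast
  show ?thesis
  proof (rule analytic_continuation_open[where s = "?U \<inter> ball 0 r" and s' = ?U and f = g and g = h])
    show "open (?U \<inter> ball 0 r)" "open ?U" "connected ?U" "?U \<inter> ball 0 r \<noteq> {}"
      using ne open_sector_open[OF ab] open_sector_convex[OF ab] by (auto intro: convex_connected)
    show "g holomorphic_on ?U" "h holomorphic_on ?U"
      using g h by (auto simp: analytic_extension_def)
    show "g z = h z" if "z \<in> ?U \<inter> ball 0 r" for z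
      using that r1(2)[of z] r2(2)[of z] by (auto simp: r_def)
  qed (use x in auto)
qed

text \<open>Uniqueness of the extension lets an explicit \<open>g\<close> stand for the chosen
  continuation. For the definite description, \<open>v\<close> must be the value in every admissible
  direction, and membership in the domain supplies at least one.\<close>

lemma borel_sum_eqI:
  assumes ab: "a < b" "b - a \<le> pi"
    and g: "analytic_extension (formal_borel f) (open_sector {a<..<b}) g"
    and z: "z \<in> borel_domain {a<..<b} \<gamma>"
    and int: "\<And>\<theta>. \<theta> \<in> {a<..<b} \<Longrightarrow> z \<in> half_plane \<theta> (\<gamma> \<theta>) \<Longrightarrow>
      ((\<lambda>\<xi>. exp (- z * of_real \<xi> * cis \<theta>) * g (of_real \<xi> * cis \<theta>) * cis \<theta>) has_integral v) {0..}"
  shows "borel_sum {a<..<b} \<gamma> f z = v"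
proof -
  let ?B = "borel_continuation {a<..<b} f"
  have B: "analytic_extension (formal_borel f) (open_sector {a<..<b}) ?B"
    unfolding borel_continuation_def using g
    by (rule someI[of "analytic_extension (formal_borel f) (open_sector {a<..<b})"])
  have intB: "((\<lambda>\<xi>. exp (- z * of_real \<xi> * cis \<theta>) * ?B (of_real \<xi> * cis \<theta>) * cis \<theta>) has_integral v) {0..}"
    if "\<theta> \<in> {a<..<b}" "z \<in> half_plane \<theta> (\<gamma> \<theta>)" for \<theta>
  \<comment> \<open>The vertex \<open>\<xi> = 0\<close> is outside the sector, so the two integrands
    may differ there; one point is negligible.\<close>
  proof (rule has_integral_spike[OF _ _ int[OF that]])
    fix \<xi> :: real assume "\<xi> \<in> {0..} - {0}"
    then have "of_real \<xi> * cis \<theta> \<in> open_sector {a<..<b}"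
      using that(1) by (intro open_sectorI) auto
    from analytic_extension_unique[OF ab B g this]
    show "exp (- z * of_real \<xi> * cis \<theta>) * ?B (of_real \<xi> * cis \<theta>) * cis \<theta> =
      exp (- z * of_real \<xi> * cis \<theta>) * g (of_real \<xi> * cis \<theta>) * cis \<theta>" by simp
  qed simp
  obtain \<theta> where "\<theta> \<in> {a<..<b}" "z \<in> half_plane \<theta> (\<gamma> \<theta>)"
    using z by (auto simp: borel_domain_def)
  then show ?thesis
    unfolding borel_sum_def using intB by (blast intro: the_equality has_integral_unique)
qed

lemma norm_phi_hat_le:
  assumes "Re s + d \<le> Re \<zeta>" "0 < d"
  shows "norm (phi_hat s \<zeta>) \<le> 1 / (1 - exp (- d))"
proof -
  have "norm (exp (s - \<zeta>)) \<le> exp (- d)" using assms by simp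
  moreover have "1 - norm (exp (s - \<zeta>)) \<le> norm (1 - exp (s - \<zeta>))"
    using norm_triangle_ineq2[of 1 "exp (s - \<zeta>)"] by simp
  ultimately have "1 - exp (- d) \<le> norm (1 - exp (s - \<zeta>))" by linarith
  moreover have "exp (- d) < 1" using assms by simp
  ultimately show ?thesis
    unfolding phi_hat_def by (simp add: norm_divide frac_le)
qed

lemma phiP_bounded:
  assumes "z \<notin> \<int>\<^sub>\<le>\<^sub>0" "r < 1"
  obtains M where "\<And>v. norm v \<le> r \<Longrightarrow> norm (phiP v z) \<le> M"
proof -
  have "continuous_on (cball 0 r) (\<lambda>v. phiP v z)"
  proof (intro continuous_at_imp_continuous_on ballI)
    fix v :: complex assume "v \<in> cball 0 r"
    then have "norm v < 1" using assms(2) by simp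
    then show "isCont (\<lambda>v. phiP v z) v"
      using phiP_deriv_arg[OF assms(1)] DERIV_isCont by blast
  qed
  then have "bounded ((\<lambda>v. phiP v z) ` cball 0 r)"
    by (intro compact_imp_bounded compact_continuous_image) auto
  then show ?thesis using that by (force simp: bounded_iff)
qed

lemma borel_domain_right_half_plane:
  "borel_domain {- pi / 2<..<pi / 2} (\<lambda>_. 0) = UNIV - \<real>\<^sub>\<le>\<^sub>0"
proof (intro Set.equalityI subsetI)
  fix z assume "z \<in> borel_domain {- pi / 2<..<pi / 2} (\<lambda>_. 0)"
  then obtain \<theta> where \<theta>: "- pi / 2 < \<theta>" "\<theta> < pi / 2" "0 < Re (z * cis \<theta>)"
    by (auto simp: borel_domain_def half_plane_def)
  show "z \<in> UNIV - \<real>\<^sub>\<le>\<^sub>0"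
  proof
    show "z \<notin> \<real>\<^sub>\<le>\<^sub>0"
    proof
      assume "z \<in> \<real>\<^sub>\<le>\<^sub>0"
      then have "Re (z * cis \<theta>) = Re z * cos \<theta>" "Re z \<le> 0"
        by (auto simp: complex_nonpos_Reals_iff)
      moreover have "cos \<theta> > 0" using \<theta> by (intro cos_gt_zero_pi) auto
      ultimately show False
        using \<theta>(3) mult_nonpos_nonneg[of "Re z" "cos \<theta>"] by linarith
    qed
  qed simp
next
  fix z :: complex assume "z \<in> UNIV - \<real>\<^sub>\<le>\<^sub>0"
  then have z: "z \<notin> \<real>\<^sub>\<le>\<^sub>0" by simp
  then have "z \<noteq> 0" by auto
  \<comment> \<open>Half of the rotation that would bring \<open>z\<close> to the positive axis:
    both \<open>\<theta>\<close> and the argument left over have modulus below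
    \<open>pi / 2\<close>.\<close>
  define \<theta> where "\<theta> = - (Arg z / 2)"
  have "Arg z \<noteq> pi" using z by (auto simp: Arg_eq_pi complex_nonpos_Reals_iff)
  then have A: "- pi < Arg z" "Arg z < pi"
    using Arg_bounded[of z] by auto
  have "z = of_real (norm z) * cis (Arg z)"
    using Arg_eq[OF \<open>z \<noteq> 0\<close>] by (simp add: cis_conv_exp)
  then have "z * cis \<theta> = of_real (norm z) * cis (Arg z + \<theta>)"
    by (metis cis_mult mult.assoc)
  then have "Re (z * cis \<theta>) = norm z * cos (Arg z / 2)"
    by (simp add: \<theta>_def)
  moreover have "cos (Arg z / 2) > 0" using A by (intro cos_gt_zero_pi) auto
  ultimately have "0 < Re (z * cis \<theta>)" using \<open>z \<noteq> 0\<close> by simp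
  then show "z \<in> borel_domain {- pi / 2<..<pi / 2} (\<lambda>_. 0)"
    using A by (auto simp: borel_domain_def half_plane_def \<theta>_def intro!: bexI[of _ "- (Arg z / 2)"])
qed

lemma Re_pos_of_mem_open_sector:
  assumes "\<zeta> \<in> open_sector {- pi / 2<..<pi / 2}"
  shows "0 < Re \<zeta>"
  using assms by (auto simp: open_sector_def intro!: mult_pos_pos cos_gt_zero_pi)

lemma borel_sum_phiP_right:
  assumes "Re s < 0" "z \<in> UNIV - \<real>\<^sub>\<le>\<^sub>0"
  shows "borel_sum {- pi / 2<..<pi / 2} (\<lambda>_. 0) (phiP_formal (exp s)) z = phiP (exp s) z"
proof (rule borel_sum_eqI[where g = "phi_hat s"])
  show "analytic_extension (formal_borel (phiP_formal (exp s))) (open_sector {- pi / 2<..<pi / 2}) (phi_hat s)"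
    by (rule phi_hat_analytic_extension[OF assms(1)])
      (metis Re_omega Re_pos_of_mem_open_sector assms(1) order_less_asym)
  show "z \<in> borel_domain {- pi / 2<..<pi / 2} (\<lambda>_. 0)"
    using assms(2) borel_domain_right_half_plane by simp
  have z: "z \<notin> \<int>\<^sub>\<le>\<^sub>0" using assms(2) by (auto elim!: nonpos_Ints_cases simp: complex_nonpos_Reals_iff)
  fix \<theta> assume "\<theta> \<in> {- pi / 2<..<pi / 2}" and hp: "z \<in> half_plane \<theta> 0"
  then have cos: "cos \<theta> > 0" by (auto intro!: cos_gt_zero_pi)
  then have re: "Re (of_real \<xi> * cis \<theta>) \<ge> 0" if "\<xi> \<ge> 0" for \<xi> using that by simp
  \<comment> \<open>The sign makes \<open>P\<close> a primitive of the integrand itself, so the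
    integral is \<open>0 - P 0\<close>.\<close>
  define P where "P = (\<lambda>t. - (exp (- z * t) * phiP (exp (s - t)) z))"
  have "exp (Re s) < 1" using assms(1) by simp
  then obtain M where M: "\<And>v. norm v \<le> exp (Re s) \<Longrightarrow> norm (phiP v z) \<le> M"
    using phiP_bounded[OF z] by blast
  have "((\<lambda>\<xi>. P (of_real \<xi> * cis \<theta>)) \<longlongrightarrow> 0) at_top"
  proof (rule Lim_null_comparison[OF _ tendsto_exp_minus_mult_at_top])
    show "\<forall>\<^sub>F \<xi> in at_top. norm (P (of_real \<xi> * cis \<theta>)) \<le> exp (- Re (z * cis \<theta>) * \<xi>) * M"
      using eventually_ge_at_top[of 0]
    proof eventually_elim
      case (elim \<xi>)
      have "norm (exp (s - of_real \<xi> * cis \<theta>)) \<le> exp (Re s)" using re[OF elim] by simp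
      then have "exp (- Re (z * cis \<theta>) * \<xi>) * norm (phiP (exp (s - of_real \<xi> * cis \<theta>)) z)
          \<le> exp (- Re (z * cis \<theta>) * \<xi>) * M"
        by (intro mult_left_mono M) auto
      then show ?case
        unfolding P_def norm_minus_cancel norm_mult[of "exp _"]
        using norm_exp_mult_cis[of z \<xi> \<theta>] by (simp add: mult.assoc)
    qed
    show "0 < Re (z * cis \<theta>)" using hp by (simp add: half_plane_def)
  qed
  then have "((\<lambda>\<xi>. exp (- z * of_real \<xi> * cis \<theta>) * phi_hat s (of_real \<xi> * cis \<theta>) * cis \<theta>) has_integral (0 - P 0)) {0..}"
  proof (rule has_integral_laplace[OF _ _ hp, rotated 2])
    fix \<xi> :: real assume \<xi>: "\<xi> \<ge> 0"
    show "(P has_field_derivative exp (- z * (of_real \<xi> * cis \<theta>)) * phi_hat s (of_real \<xi> * cis \<theta>)) (at (of_real \<xi> * cis \<theta>))"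
      unfolding P_def using DERIV_minus[OF laplace_primitive_right[OF z, of s "of_real \<xi> * cis \<theta>"]]
        re[OF \<xi>] assms(1) by simp
    show "norm (phi_hat s (of_real \<xi> * cis \<theta>)) \<le> 1 / (1 - exp (Re s)) * exp (0 * \<xi>)"
      using norm_phi_hat_le[of s "- Re s" "of_real \<xi> * cis \<theta>"] re[OF \<xi>] assms(1) by simp
  qed
  then show "((\<lambda>\<xi>. exp (- z * of_real \<xi> * cis \<theta>) * phi_hat s (of_real \<xi> * cis \<theta>) * cis \<theta>) has_integral phiP (exp s) z) {0..}"
    by (simp add: P_def)
qed (use pi_gt_zero in auto)

lemma phiP_formal_nth_0 [simp]: "phiP_formal w $ 0 = 0"
  by (simp add: phiP_formal_def)

lemma locally_bounded_on_const [simp]: "locally_bounded_on I (\<lambda>_. c)"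
  by (auto simp: locally_bounded_on_def image_constant_conv intro!: exI[of _ "1::real"])

lemma phi_hat_N_sector_right:
  assumes "Re s < 0"
  shows "formal_borel (phiP_formal (exp s)) \<in> N_sector {- pi / 2<..<pi / 2} (\<lambda>_. 0)"
proof -
  have "analytic_extension (formal_borel (phiP_formal (exp s))) (open_sector {- pi / 2<..<pi / 2}) (phi_hat s)"
    by (rule phi_hat_analytic_extension[OF assms(1)])
      (metis Re_omega Re_pos_of_mem_open_sector assms(1) order_less_asym)
  moreover have "norm (phi_hat s (of_real \<xi> * cis \<theta>)) \<le> 1 / (1 - exp (Re s)) * exp (0 * \<xi>)"
    if "\<theta> \<in> {- pi / 2<..<pi / 2}" "\<xi> > 0" for \<theta> \<xi>
  proof -
    have "cos \<theta> > 0" using that by (auto intro!: cos_gt_zero_pi)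
    then show ?thesis
      using norm_phi_hat_le[of s "- Re s" "of_real \<xi> * cis \<theta>"] that assms by simp
  qed
  moreover have "0 \<le> 1 / (1 - exp (Re s))" using assms by simp
  ultimately show ?thesis
    unfolding N_sector_def
    by (intro CollectI exI[of _ "phi_hat s"] exI[of _ "\<lambda>_. 1 / (1 - exp (Re s))"]) simp
qed

lemma phi_hat_N_ray:
  assumes "Re s < 0" "cos \<theta> = 0"
  shows "formal_borel (phiP_formal (exp s)) \<in> N_ray 0 \<theta>"
proof -
  \<comment> \<open>Half the distance from the imaginary axis to the line of poles: the strip keeps
    a margin \<open>\<delta>\<close> from that line.\<close>
  define \<delta> where "\<delta> = - Re s / 2"
  have "\<delta> > 0" using assms by (simp add: \<delta>_def)
  let ?L = "{of_real t * cis \<theta> | t. t \<ge> 0}"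
  have re: "Re \<zeta> \<ge> Re s + \<delta>" if "\<zeta> \<in> strip \<theta> \<delta>" for \<zeta>
  proof -
    have ne: "?L \<noteq> {}" by blast
    have "infdist \<zeta> ?L < \<delta>" using that by (simp only: strip_def mem_Collect_eq)
    then have "Inf (dist \<zeta> ` ?L) < \<delta>" unfolding infdist_notempty[OF ne] .
    then obtain p where p: "p \<in> ?L" "dist \<zeta> p < \<delta>"
      using cInf_lessD[of "dist \<zeta> ` ?L"] ne by blast
    then have "Re p = 0" using assms(2) by auto
    moreover have "\<bar>Re (\<zeta> - p)\<bar> < \<delta>"
      using p(2) abs_Re_le_cmod[of "\<zeta> - p"] by (simp add: dist_norm)
    ultimately show ?thesis by (simp add: \<delta>_def)
  qed
  have "analytic_extension (formal_borel (phiP_formal (exp s))) (strip \<theta> \<delta>) (phi_hat s)"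
    using assms(1) \<open>\<delta> > 0\<close> by (intro phi_hat_analytic_extension) (auto dest!: re)
  moreover have "norm (phi_hat s \<zeta>) \<le> 1 / (1 - exp (- \<delta>)) * exp (0 * norm \<zeta>)" if "\<zeta> \<in> strip \<theta> \<delta>" for \<zeta>
    using norm_phi_hat_le[OF re[OF that] \<open>\<delta> > 0\<close>] by simp
  moreover have "0 < 1 / (1 - exp (- \<delta>))" using \<open>\<delta> > 0\<close> by simp
  ultimately show ?thesis
    unfolding N_ray_def using \<open>\<delta> > 0\<close>
    by (intro CollectI exI[of _ \<delta>] exI[of _ "1 / (1 - exp (- \<delta>))"] exI[of _ "phi_hat s"] conjI) auto
qed

section \<open>Directions between consecutive poles\<close>

text \<open>Signed distance to the line through 0 with direction \<open>\<theta>\<close>, positive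
  to the left of that direction. When \<open>cos \<theta> < 0\<close>, the heights of the poles form
  an arithmetic progression increasing with the index, so gaps between poles become strips.\<close>

definition height :: "real \<Rightarrow> complex \<Rightarrow> real" where
  "height \<theta> \<zeta> = Im (\<zeta> * cis (- \<theta>))"

lemma height_add: "height \<theta> (x + y) = height \<theta> x + height \<theta> y"
  by (simp add: height_def algebra_simps)

lemma height_ray [simp]: "height \<theta> (of_real \<xi> * cis \<theta>) = 0"
  by (simp add: height_def mult.assoc cis_mult)

lemma height_2pi_i [simp]: "height \<theta> (2 * of_real pi * \<i>) = 2 * pi * cos \<theta>"
  by (simp add: height_def)

lemma open_height_strip: "open {t. a < height \<theta> t \<and> height \<theta> t < b}"
  unfolding height_def by (intro open_Collect_conj open_Collect_less continuous_intros)

lemma convex_height_strip: "convex {t. a < height \<theta> t \<and> height \<theta> t < b}"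
proof -
  have "linear (\<lambda>z::complex. z * c)" for c by (rule bounded_linear.linear[OF bounded_linear_mult_left])
  then have "convex ((\<lambda>z. z * cis (- \<theta>)) -` {z. Im z > a} \<inter> (\<lambda>z. z * cis (- \<theta>)) -` {z. Im z < b})"
    by (intro convex_Int convex_linear_vimage convex_halfspace_Im_gt convex_halfspace_Im_lt)
  then show ?thesis
    by (simp add: vimage_def Collect_conj_eq height_def)
qed

lemma omega_add_1: "omega s (k + 1) = omega s k - 2 * of_real pi * \<i>"
  by (simp add: omega_def algebra_simps)

lemma height_omega: "height \<theta> (omega s j) = height \<theta> s - 2 * pi * of_int j * cos \<theta>"
  by (simp add: height_def omega_def algebra_simps)

lemma height_omega_less_iff:
  assumes "cos \<theta> < 0"
  shows "height \<theta> (omega s j) < height \<theta> (omega s k) \<longleftrightarrow> j < k"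
proof -
  have "height \<theta> (omega s j) < height \<theta> (omega s k) \<longleftrightarrow>
      (2 * pi * - cos \<theta>) * of_int j < (2 * pi * - cos \<theta>) * of_int k"
    by (simp add: height_omega algebra_simps)
  also have "\<dots> \<longleftrightarrow> j < k"
    using assms by (subst mult_less_cancel_left_pos) (auto simp: mult_pos_neg)
  finally show ?thesis .
qed

section \<open>Arguments of the poles and the intervals between them\<close>

lemma omega_polar: "omega s k = of_real (norm (omega s k)) * cis (arg_omega s k)"
  using Arg2pi_eq[of "omega s k"] by (simp add: arg_omega_def cis_conv_exp mult.commute)

lemma arg_omega_bounds:
  assumes "Re s < 0"
  shows "pi / 2 < arg_omega s k" "arg_omega s k < 3 * pi / 2"
proof -
  let ?t = "arg_omega s k"
  have "norm (omega s k) * cos ?t < 0"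
    using assms arg_cong[OF omega_polar[of s k], of Re] by simp
  then have c: "cos ?t < 0" by (simp add: mult_less_0_iff not_less)
  have t: "0 \<le> ?t" "?t < 2 * pi"
    using Arg2pi_ge_0 Arg2pi_lt_2pi by (simp_all add: arg_omega_def)
  show "pi / 2 < ?t" using c t cos_ge_zero[of ?t] by force
  show "?t < 3 * pi / 2"
  proof (rule ccontr)
    assume "\<not> ?t < 3 * pi / 2"
    then have "0 \<le> cos (?t - 2 * pi)" using t by (intro cos_ge_zero) auto
    with c show False by (simp add: cos_diff)
  qed
qed

lemma height_omega_sin: "height \<theta> (omega s k) = norm (omega s k) * sin (arg_omega s k - \<theta>)"
  by (subst omega_polar) (simp add: height_def mult.assoc cis_mult)

text \<open>The two angles differ by less than \<open>pi\<close>, so the sine of their difference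
  has the sign of the difference.\<close>

lemma height_omega_neg_iff:
  assumes "Re s < 0" "pi / 2 \<le> \<theta>" "\<theta> \<le> 3 * pi / 2"
  shows "height \<theta> (omega s k) < 0 \<longleftrightarrow> arg_omega s k < \<theta>"
    and "height \<theta> (omega s k) > 0 \<longleftrightarrow> arg_omega s k > \<theta>"
proof -
  let ?t = "arg_omega s k"
  have n: "norm (omega s k) > 0" using Re_omega[of s k] assms(1) by (metis complex.sel(1) less_irrefl zero_complex.sel(1) zero_less_norm_iff)
  have 1: "sin (?t - \<theta>) > 0" if "?t > \<theta>"
    using that arg_omega_bounds[OF assms(1), of k] assms by (intro sin_gt_zero) auto
  have 2: "sin (\<theta> - ?t) > 0" if "?t < \<theta>"
    using that arg_omega_bounds[OF assms(1), of k] assms by (intro sin_gt_zero) auto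
  have 3: "sin (\<theta> - ?t) = - sin (?t - \<theta>)" by (simp add: sin_diff)
  show "height \<theta> (omega s k) < 0 \<longleftrightarrow> ?t < \<theta>" "height \<theta> (omega s k) > 0 \<longleftrightarrow> ?t > \<theta>"
    using 1 2 3 n by (cases ?t \<theta> rule: linorder_cases;
      simp add: height_omega_sin mult_less_0_iff zero_less_mult_iff)+
qed

lemma cos_neg_left_half_plane: "pi / 2 < \<theta> \<Longrightarrow> \<theta> < 3 * pi / 2 \<Longrightarrow> cos \<theta> < 0"
  using cos_gt_zero_pi[of "\<theta> - pi"] by (simp add: cos_diff)

text \<open>On the ray through \<open>omega s k\<close> that pole has height 0, so the next one has
  positive height, which means a larger argument.\<close>

lemma arg_omega_less:
  assumes "Re s < 0"
  shows "arg_omega s k < arg_omega s (k + 1)"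
proof -
  let ?\<theta> = "arg_omega s k"
  note b = arg_omega_bounds[OF assms, of k]
  have "height ?\<theta> (omega s k) = 0" by (simp add: height_omega_sin)
  then have "height ?\<theta> (omega s (k + 1)) > 0"
    using height_omega_less_iff[OF cos_neg_left_half_plane[OF b], of s k "k + 1"] by simp
  then show ?thesis using height_omega_neg_iff(2)[OF assms, of ?\<theta> "k + 1"] b by simp
qed

lemma mem_J_bounds:
  assumes "Re s < 0" "\<theta> \<in> J s k"
  shows "pi / 2 < \<theta>" "\<theta> < 3 * pi / 2" "cos \<theta> < 0"
proof -
  show "pi / 2 < \<theta>" "\<theta> < 3 * pi / 2"
    using assms(2) arg_omega_bounds[OF assms(1), of k] arg_omega_bounds[OF assms(1), of "k + 1"]
    by (auto simp: J_def)
  then show "cos \<theta> < 0" by (rule cos_neg_left_half_plane)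
qed

lemma J_subset:
  assumes "Re s < 0"
  shows "J s k \<subset> {pi / 2 <..< 3 * pi / 2}"
proof
  show "J s k \<subseteq> {pi / 2 <..< 3 * pi / 2}" using mem_J_bounds[OF assms, of _ k] by auto
  have "arg_omega s k \<in> {pi / 2 <..< 3 * pi / 2} - J s k"
    using arg_omega_bounds[OF assms, of k] by (simp add: J_def)
  then show "J s k \<noteq> {pi / 2 <..< 3 * pi / 2}" by blast
qed

lemma J_length:
  assumes "Re s < 0"
  shows "arg_omega s (k + 1) - arg_omega s k \<le> pi"
  using arg_omega_bounds[OF assms, of k] arg_omega_bounds[OF assms, of "k + 1"] by linarith

lemma height_omega_J:
  assumes "Re s < 0" "\<theta> \<in> J s k"
  shows "height \<theta> (omega s k) < 0" "0 < height \<theta> (omega s (k + 1))"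
  using height_omega_neg_iff[OF assms(1), of \<theta>] mem_J_bounds[OF assms] assms(2)
  by (auto simp: J_def)

lemma height_omega_not_between:
  assumes "cos \<theta> < 0"
  shows "\<not> (height \<theta> (omega s k) < height \<theta> (omega s j) \<and> height \<theta> (omega s j) < height \<theta> (omega s (k + 1)))"
  using height_omega_less_iff[OF assms] by auto

text \<open>The ray has height 0, strictly between the heights of two consecutive poles.\<close>

lemma ray_ne_omega:
  assumes "Re s < 0" "\<theta> \<in> J s k"
  shows "of_real \<xi> * cis \<theta> \<noteq> omega s j"
  using height_omega_not_between[OF mem_J_bounds(3)[OF assms], of s k j] height_omega_J[OF assms]
  by (metis height_ray)

lemma phi_hat_analytic_extension_J:
  assumes "Re s < 0"
  shows "analytic_extension (formal_borel (phiP_formal (exp s))) (open_sector (J s k)) (phi_hat s)"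
  by (rule phi_hat_analytic_extension[OF assms])
    (use ray_ne_omega[OF assms] in \<open>auto simp: open_sector_def\<close>)

section \<open>Exponential bounds in the left half-plane\<close>

text \<open>Writing \<open>phi_hat s \<zeta> = exp \<zeta> / (exp \<zeta> - exp s)\<close> isolates
  the exponential rate \<open>cos \<theta>\<close>; the remaining factor only has to be
  bounded.\<close>

lemma norm_phi_hat_ray:
  "norm (phi_hat s (of_real \<xi> * cis \<theta>)) =
     norm (1 / (exp (of_real \<xi> * cis \<theta>) - exp s)) * exp (cos \<theta> * \<xi>)"
proof -
  let ?\<zeta> = "of_real \<xi> * cis \<theta>"
  have "phi_hat s ?\<zeta> = 1 / (exp ?\<zeta> - exp s) * exp ?\<zeta>"
    by (simp add: phi_hat_def exp_diff divide_simps)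
  then have "norm (phi_hat s ?\<zeta>) = norm (1 / (exp ?\<zeta> - exp s)) * norm (exp ?\<zeta>)"
    by (simp only: norm_mult)
  then show ?thesis by (simp add: mult.commute)
qed

text \<open>A bounded range of \<open>\<xi>\<close> is handled by compactness, since no ray meets a
  pole; beyond it \<open>exp \<zeta>\<close> is uniformly smaller than \<open>exp s\<close> in
  modulus.\<close>

lemma phi_hat_bound_compact:
  assumes "Re s < 0" "{a..b} \<subseteq> J s k"
  obtains M where "\<And>\<theta> \<xi>. \<theta> \<in> {a..b} \<Longrightarrow> \<xi> \<ge> 0 \<Longrightarrow> norm (1 / (exp (of_real \<xi> * cis \<theta>) - exp s)) \<le> M"
proof (cases "a \<le> b")
  case False
  then show ?thesis by (intro that[of 0]) auto
next
  case True
  have "continuous_on {a..b} cos" by (intro continuous_intros)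
  \<comment> \<open>\<open>\<theta>0\<close> is the direction of slowest decay of
    \<open>exp \<zeta>\<close>.\<close>
  then obtain \<theta>0 where \<theta>0: "\<theta>0 \<in> {a..b}" "\<And>\<theta>. \<theta> \<in> {a..b} \<Longrightarrow> cos \<theta> \<le> cos \<theta>0"
    using continuous_attains_sup[of "{a..b}" cos] True by auto
  have c0: "cos \<theta>0 < 0" using mem_J_bounds(3)[OF assms(1)] \<theta>0(1) assms(2) by blast
  \<comment> \<open>Chosen so that \<open>Re \<zeta> \<le> Re s - 1\<close> beyond radius
    \<open>R\<close>, for all directions of the interval at once.\<close>
  define R where "R = (Re s - 1) / cos \<theta>0"
  have "R > 0" using c0 assms(1) by (simp add: R_def zero_less_divide_iff)
  define q where "q = (\<lambda>(\<xi>, \<theta>). 1 / (exp (of_real \<xi> * cis \<theta>) - exp s))"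
  have ne: "exp (of_real \<xi> * cis \<theta>) - exp s \<noteq> 0" if "\<theta> \<in> {a..b}" for \<xi> \<theta>
  proof
    assume "exp (of_real \<xi> * cis \<theta>) - exp s = 0"
    then have "exp (s - of_real \<xi> * cis \<theta>) = 1" by (simp add: exp_diff)
    moreover have "\<theta> \<in> J s k" using that assms(2) by blast
    ultimately show False
      using ray_ne_omega[OF assms(1)] by (auto simp: exp_diff_eq_1_iff_omega)
  qed
  have "continuous_on ({0..R} \<times> {a..b}) q"
    unfolding q_def case_prod_unfold using ne by (intro continuous_intros) auto
  then have "bounded (q ` ({0..R} \<times> {a..b}))"
    by (intro compact_imp_bounded compact_continuous_image compact_Times) auto
  then obtain M1 where "\<forall>x\<in>q ` ({0..R} \<times> {a..b}). norm x \<le> M1"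
    unfolding bounded_iff by blast
  then have M1: "norm (q (\<xi>, \<theta>)) \<le> M1" if "\<xi> \<in> {0..R}" "\<theta> \<in> {a..b}" for \<xi> \<theta>
    using that by blast
  define M2 where "M2 = 1 / (exp (Re s) - exp (Re s - 1))"
  show ?thesis
  proof (rule that[of "max M1 M2"])
    fix \<theta> \<xi> :: real assume \<theta>: "\<theta> \<in> {a..b}" and \<xi>: "\<xi> \<ge> 0"
    show "norm (1 / (exp (of_real \<xi> * cis \<theta>) - exp s)) \<le> max M1 M2"
    proof (cases "\<xi> \<le> R")
      case True
      with M1[of \<xi> \<theta>] \<theta> \<xi> show ?thesis by (simp add: q_def)
    next
      case False
      have "\<xi> * cos \<theta> \<le> \<xi> * cos \<theta>0" using \<xi> \<theta>0(2)[OF \<theta>] by (rule mult_left_mono[rotated])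
      also have "\<dots> \<le> R * cos \<theta>0" using False c0 by (intro mult_right_mono_neg) auto
      also have "\<dots> = Re s - 1" using c0 by (simp add: R_def)
      finally have "norm (exp (of_real \<xi> * cis \<theta>)) \<le> exp (Re s - 1)" by simp
      then have "exp (Re s) - exp (Re s - 1) \<le> norm (exp (of_real \<xi> * cis \<theta>) - exp s)"
        using norm_triangle_ineq3[of "exp (of_real \<xi> * cis \<theta>)" "exp s"] norm_exp_eq_Re[of s] by linarith
      moreover have "exp (Re s - 1) < exp (Re s)" by simp
      ultimately have "norm (1 / (exp (of_real \<xi> * cis \<theta>) - exp s)) \<le> M2"
        unfolding M2_def by (simp only: norm_divide norm_one) (rule frac_le, auto)
      then show ?thesis by simp
    qed
  qed
qed

lemma phi_hat_bound_ray:
  assumes "Re s < 0" "\<theta> \<in> J s k"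
  obtains M where "\<And>\<xi>. \<xi> \<ge> 0 \<Longrightarrow> norm (phi_hat s (of_real \<xi> * cis \<theta>)) \<le> M * exp (cos \<theta> * \<xi>)"
proof -
  have "{\<theta>..\<theta>} \<subseteq> J s k" using assms(2) by simp
  then obtain M where "\<And>\<theta>' \<xi>. \<theta>' \<in> {\<theta>..\<theta>} \<Longrightarrow> \<xi> \<ge> 0 \<Longrightarrow> norm (1 / (exp (of_real \<xi> * cis \<theta>') - exp s)) \<le> M"
    using phi_hat_bound_compact[OF assms(1)] by blast
  then show ?thesis
    by (intro that[of M]) (simp add: norm_phi_hat_ray del: divide_divide_eq_left)
qed

lemma locally_bounded_on_cos [simp]: "locally_bounded_on I cos"
  unfolding locally_bounded_on_def bounded_iff
  by (intro ballI exI[of _ "1::real"] conjI zero_less_one) auto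

lemma phi_hat_N_sector_J:
  assumes "Re s < 0"
  shows "formal_borel (phiP_formal (exp s)) \<in> N_sector (J s k) cos"
proof -
  define q where "q = (\<lambda>\<xi> \<theta>. norm (1 / (exp (of_real \<xi> * cis \<theta>) - exp s)))"
  \<comment> \<open>The supremum over the ray gives one canonical bound per direction; it is finite
    by the compact bound on a one-point interval, and locally bounded by the same bound on a small
    closed interval.\<close>
  define \<alpha> where "\<alpha> = (\<lambda>\<theta>. SUP \<xi>\<in>{0..}. q \<xi> \<theta>)"
  have q0: "q \<xi> \<theta> \<ge> 0" for \<xi> \<theta> by (simp add: q_def)
  have le: "q \<xi> \<theta> \<le> \<alpha> \<theta>" if "\<theta> \<in> J s k" "\<xi> \<ge> 0" for \<theta> \<xi>
  proof -
    have "{\<theta>..\<theta>} \<subseteq> J s k" using that by simp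
    then obtain M where "\<And>\<theta>' \<xi>. \<theta>' \<in> {\<theta>..\<theta>} \<Longrightarrow> \<xi> \<ge> 0 \<Longrightarrow> q \<xi> \<theta>' \<le> M"
      using phi_hat_bound_compact[OF assms] unfolding q_def by blast
    then have "bdd_above ((\<lambda>\<xi>. q \<xi> \<theta>) ` {0..})" by (intro bdd_aboveI2[of _ _ M]) auto
    then show ?thesis unfolding \<alpha>_def using that by (intro cSUP_upper) auto
  qed
  have \<alpha>0: "\<alpha> \<theta> \<ge> 0" if "\<theta> \<in> J s k" for \<theta>
    using le[OF that, of 0] q0[of 0 \<theta>] by simp
  have "locally_bounded_on (J s k) \<alpha>"
    unfolding locally_bounded_on_def
  proof
    fix \<theta> assume "\<theta> \<in> J s k"
    moreover have "open (J s k)" by (simp add: J_def)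
    ultimately obtain e where e: "e > 0" "cball \<theta> e \<subseteq> J s k"
      using open_contains_cball by blast
    then have "{\<theta> - e..\<theta> + e} \<subseteq> J s k" by (simp add: cball_eq_atLeastAtMost)
    then obtain M where M: "\<And>\<theta>' \<xi>. \<theta>' \<in> {\<theta> - e..\<theta> + e} \<Longrightarrow> \<xi> \<ge> 0 \<Longrightarrow> q \<xi> \<theta>' \<le> M"
      using phi_hat_bound_compact[OF assms] unfolding q_def by blast
    have "norm (\<alpha> \<theta>') \<le> M" if "\<theta>' \<in> J s k \<inter> ball \<theta> e" for \<theta>'
    proof -
      have "\<theta>' \<in> {\<theta> - e..\<theta> + e}" using that by (auto simp: dist_real_def)
      then have "\<alpha> \<theta>' \<le> M" unfolding \<alpha>_def by (intro cSUP_least M) auto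
      with \<alpha>0[of \<theta>'] that show ?thesis by simp
    qed
    then show "\<exists>e>0. bounded (\<alpha> ` (J s k \<inter> ball \<theta> e))"
      using e(1) unfolding bounded_iff by blast
  qed
  moreover have "norm (phi_hat s (of_real \<xi> * cis \<theta>)) \<le> \<alpha> \<theta> * exp (cos \<theta> * \<xi>)"
    if "\<theta> \<in> J s k" "\<xi> > 0" for \<theta> \<xi>
    unfolding norm_phi_hat_ray using le[of \<theta> \<xi>] that by (simp add: q_def)
  ultimately show ?thesis
    unfolding N_sector_def using phi_hat_analytic_extension_J[OF assms, of k] \<alpha>0
    by (intro CollectI exI[of _ "phi_hat s"] exI[of _ \<alpha>]) simp
qed

section \<open>The domain of the Borel sum as a neighbourhood of infinity\<close>

text \<open>Every boundary line passes through 1, whatever the direction; in particular 1 is never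
  in the domain.\<close>

lemma mem_half_plane_cos_iff: "z \<in> half_plane \<theta> (cos \<theta>) \<longleftrightarrow> 0 < Re ((z - 1) * cis \<theta>)"
  by (simp add: half_plane_def algebra_simps)

text \<open>Half-planes with boundary through 1 sweep a sector with vertex 1 as their direction
  varies, so the same vertex serves for every \<open>\<epsilon>\<close>.\<close>

lemma sectorial_nbhd_borel_domain_cos:
  assumes "a < b"
  shows "sectorial_nbhd_infinity a b (borel_domain {a<..<b} cos)"
  unfolding sectorial_nbhd_infinity_def
proof (intro allI impI exI subsetI)
  fix \<epsilon> :: real and z assume "\<epsilon> > 0" and "z \<in> sector_at 1 (- ((a + b) / 2)) (pi + (b - a) - \<epsilon>)"
  then obtain r t where z: "z = 1 + of_real r * cis (- ((a + b) / 2) + t)" "r > 0"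
    and t: "\<bar>t\<bar> < (pi + (b - a)) / 2"
    by (auto simp: sector_at_def)
  \<comment> \<open>The angle is split as \<open>t = u * pi + u * (b - a)\<close> with
    \<open>\<bar>u\<bar> < 1 / 2\<close>. The second share is absorbed by moving
    \<open>\<theta>\<close> off the midpoint within the interval; the first is the argument left to
    \<open>(z - 1) * cis \<theta>\<close>.\<close>
  define u where "u = t / (pi + (b - a))"
  have p: "pi + (b - a) > 0" using assms pi_gt_zero by linarith
  have u: "\<bar>u\<bar> < 1 / 2" using t p by (simp add: u_def divide_simps)
  have "t = u * (pi + (b - a))" using p by (simp add: u_def)
  then have tu: "t = u * pi + u * (b - a)" by (simp only: distrib_left)
  define \<theta> where "\<theta> = (a + b) / 2 - u * (b - a)"
  have "\<bar>u * (b - a)\<bar> < 1 / 2 * (b - a)"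
    unfolding abs_mult using u assms by (simp add: abs_if)
  then have "u * (b - a) < 1 / 2 * (b - a)" "- (u * (b - a)) < 1 / 2 * (b - a)"
    by (simp_all only: abs_less_iff)
  then have "a < \<theta>" "\<theta> < b" unfolding \<theta>_def by argo+
  then have "\<theta> \<in> {a<..<b}" by simp
  moreover have "(z - 1) * cis \<theta> = of_real r * cis (u * pi)"
    unfolding z \<theta>_def tu by (simp add: mult.assoc cis_mult)
  moreover have "\<bar>u * pi\<bar> < 1 / 2 * pi"
    unfolding abs_mult using u by (simp add: abs_if)
  then have "u * pi < 1 / 2 * pi" "- (u * pi) < 1 / 2 * pi"
    by (simp_all only: abs_less_iff)
  then have "cos (u * pi) > 0" by (intro cos_gt_zero_pi) argo+
  ultimately have "\<theta> \<in> {a<..<b}" "0 < Re ((z - 1) * cis \<theta>)"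
    using z(2) by simp_all
  then show "z \<in> borel_domain {a<..<b} cos"
    unfolding borel_domain_def mem_half_plane_cos_iff[symmetric] by blast
qed

lemma real_halfline_subset_borel_domain_J:
  assumes "Re s < 0"
  shows "of_real ` {..<1} \<subseteq> borel_domain (J s k) cos"
proof
  fix z :: complex assume "z \<in> of_real ` {..<1}"
  then obtain x where x: "z = of_real x" "x < 1" by auto
  obtain \<theta> where \<theta>: "\<theta> \<in> J s k"
    using dense[OF arg_omega_less[OF assms, of k]] by (auto simp: J_def)
  have "Re ((z - 1) * cis \<theta>) = (x - 1) * cos \<theta>" by (simp add: x)
  also have "\<dots> > 0" using x(2) mem_J_bounds(3)[OF assms \<theta>] by (simp add: mult_neg_neg)
  finally show "z \<in> borel_domain (J s k) cos"
    using \<theta> by (auto simp: borel_domain_def mem_half_plane_cos_iff)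
qed

section \<open>Crossing the line of poles\<close>

text \<open>The expected continuation of the Borel sum. At integers the fraction takes the default
  value of a division by 0, hence the later use of \<open>remove_sings\<close>.\<close>

definition phiP_cont :: "complex \<Rightarrow> int \<Rightarrow> complex \<Rightarrow> complex" where
  "phiP_cont s k z = phiP (exp s) z -
     2 * of_real pi * \<i> * (exp (- omega s k * z) / (1 - exp (- 2 * of_real pi * \<i> * z)))"

lemma exp_2pi_i_eq_1_iff: "exp (2 * of_real pi * \<i> * z) = 1 \<longleftrightarrow> z \<in> \<int>"
proof -
  have "exp (2 * of_real pi * \<i> * z) = 1 \<longleftrightarrow> (\<exists>n::int. z = of_int n)"
    by (subst exp_eq_1) (auto simp: complex_eq_iff)
  then show ?thesis by (auto simp: Ints_def)
qed

lemma exp_minus_2pi_i_eq_1_iff: "exp (- 2 * of_real pi * \<i> * z) = 1 \<longleftrightarrow> z \<in> \<int>"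
  using exp_2pi_i_eq_1_iff[of "- z"] by simp

lemma exp_add_2pi_i [simp]: "exp (x + 2 * of_real pi * \<i>) = exp x"
  by (simp add: exp_add)

lemma exp_omega [simp]: "exp (omega s k) = exp s" "exp (s - omega s k) = 1"
  using exp_diff_eq_1_iff_omega[of s "omega s k"] by (auto simp: exp_diff divide_simps)

lemma phi_hat_add_2pi_i: "phi_hat s (t + 2 * of_real pi * \<i>) = phi_hat s t"
  by (simp add: phi_hat_def exp_diff)

lemma exp_mult_add_2pi_i:
  "exp (- z * (t + 2 * of_real pi * \<i>)) = exp (- 2 * of_real pi * \<i> * z) * exp (- z * t)"
  by (simp add: exp_add[symmetric] algebra_simps)

lemma phi_hat_residue: "((\<lambda>t. (t - omega s k) * phi_hat s t) \<longlongrightarrow> 1) (at (omega s k))"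
proof -
  have "((\<lambda>t. 1 - exp (s - t)) has_field_derivative exp (s - omega s k)) (at (omega s k))"
    by (auto intro!: derivative_eq_intros)
  then have "((\<lambda>t. (1 - exp (s - t)) / (t - omega s k)) \<longlongrightarrow> 1) (at (omega s k))"
    by (simp add: has_field_derivative_iff)
  from tendsto_inverse[OF this] show ?thesis by (simp add: phi_hat_def field_simps)
qed

lemma Re_one_minus_pos:
  fixes v :: complex assumes "norm v < 1" shows "0 < Re (1 - v)" "1 - v \<notin> \<real>\<^sub>\<le>\<^sub>0"
  using complex_Re_le_cmod[of v] assms by (auto simp: complex_nonpos_Reals_iff)

text \<open>With \<open>v = exp (s - t)\<close> one has
  \<open>phi_hat s t = 1 + v / (1 - v)\<close>, whence the summand \<open>t\<close>. The logarithm
  is invariant under translation by \<open>2 * pi * \<i>\<close>; the increment of \<open>t\<close>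
  carries the residue.\<close>

lemma phi_hat_primitive_right:
  assumes "Re s < Re t"
  shows "((\<lambda>t. t + Ln (1 - exp (s - t))) has_field_derivative phi_hat s t) (at t)"
proof -
  have n: "norm (exp (s - t)) < 1" using assms by simp
  note 1 = Re_one_minus_pos[OF n]
  have "1 - exp (s - t) \<noteq> 0" using 1 by auto
  then have "1 + exp (s - t) / (1 - exp (s - t)) = phi_hat s t"
    by (simp add: phi_hat_def divide_simps)
  moreover have "((\<lambda>t. t + Ln (1 - exp (s - t))) has_field_derivative
      1 + exp (s - t) / (1 - exp (s - t))) (at t)"
    using 1(2) by (auto intro!: derivative_eq_intros simp: divide_inverse mult.commute)
  ultimately show ?thesis by simp
qed

text \<open>Here \<open>phi_hat s\<close> is a power series in \<open>exp (t - s)\<close> without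
  constant term, so no linear summand occurs and the primitive is periodic. This asymmetry produces
  the connection constant.\<close>

lemma phi_hat_primitive_left:
  assumes "Re t < Re s"
  shows "((\<lambda>t. Ln (1 - exp (t - s))) has_field_derivative phi_hat s t) (at t)"
proof -
  have n: "norm (exp (t - s)) < 1" using assms by simp
  note 1 = Re_one_minus_pos[OF n]
  have "1 - exp (t - s) \<noteq> 0" using 1 by auto
  then have "- exp (t - s) / (1 - exp (t - s)) = phi_hat s t"
    by (auto simp add: phi_hat_def exp_diff divide_simps algebra_simps)
  moreover have "((\<lambda>t. Ln (1 - exp (t - s))) has_field_derivative
      - exp (t - s) / (1 - exp (t - s))) (at t)"
    using 1(2) by (auto intro!: derivative_eq_intros simp: divide_inverse mult.commute)
  ultimately show ?thesis by simp
qed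

lemma primitives_differ_by_const:
  assumes "convex S"
    and "\<And>x. x \<in> S \<Longrightarrow> (f has_field_derivative d x) (at x)"
    and "\<And>x. x \<in> S \<Longrightarrow> (g has_field_derivative d x) (at x)"
  shows "\<exists>c :: complex. \<forall>x\<in>S. f x = g x + c"
proof -
  have "\<exists>c. \<forall>x\<in>S. f x - g x = c"
  proof (rule has_field_derivative_zero_constant[OF assms(1)])
    fix x assume "x \<in> S"
    then show "((\<lambda>x. f x - g x) has_field_derivative 0) (at x within S)"
      using DERIV_diff[OF assms(2,3)[of x]] by (auto intro: has_field_derivative_at_within)
  qed
  then show ?thesis by (metis diff_eq_eq add.commute)
qed

text \<open>
  Subtracting \<open>exp (- z \<omega>) \<phi>\<close> from \<open>exp (- z t) \<phi> t\<close> removes the single pole \<open>\<omega>\<close> of the strip;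
  the difference \<open>Q (t + 2 \<pi> i) - Q t\<close> of the primitive of the result is, by periodicity of \<open>\<phi>\<close>,
  a multiple of a primitive of \<open>exp (- z t) \<phi> t\<close>. This replaces the residue theorem.
\<close>
lemma laplace_primitive_J:
  fixes s z :: complex and k :: int
  assumes s: "Re s < 0" and cos: "cos \<theta> < 0" and z: "z \<notin> \<int>"
  defines "N \<equiv> {t. height \<theta> (omega s k) < height \<theta> t \<and> height \<theta> t < height \<theta> (omega s (k + 1))}"
  obtains P where
    "\<And>t. t \<in> N \<Longrightarrow> (P has_field_derivative exp (- z * t) * phi_hat s t) (at t)"
    "\<And>t. t \<in> N \<Longrightarrow> Re t < Re s \<Longrightarrow> P t = - (exp ((1 - z) * t - s) * phiP (exp (t - s)) (1 - z))"
    "\<And>t. t \<in> N \<Longrightarrow> Re s < Re t \<Longrightarrow> P t = - (exp (- z * t) * phiP (exp (s - t)) z) +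
        2 * of_real pi * \<i> * (exp (- omega s k * z) / (1 - exp (- 2 * of_real pi * \<i> * z)))"
proof -
  define c where "c = exp (- 2 * of_real pi * \<i> * z)"
  have c: "c \<noteq> 1" using z exp_minus_2pi_i_eq_1_iff[of z] by (simp add: c_def)
  define \<omega> where "\<omega> = omega s k"
  \<comment> \<open>\<open>S\<close> contains the gap \<open>N\<close>, its translate by
    \<open>2 * pi * \<i>\<close>, and the pole \<open>\<omega>\<close> between them, because
    \<open>omega s (k - 1)\<close> is \<open>omega s k\<close> translated by that period.\<close>
  define S where "S = {t. height \<theta> (omega s (k - 1)) < height \<theta> t \<and> height \<theta> t < height \<theta> (omega s (k + 1))}"
  have S: "open S" "convex S"
    unfolding S_def by (rule open_height_strip convex_height_strip)+
  have hm: "height \<theta> (omega s (k - 1)) < height \<theta> \<omega>" "height \<theta> \<omega> < height \<theta> (omega s (k + 1))"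
    unfolding \<omega>_def using height_omega_less_iff[OF cos] by simp_all
  then have \<omega>S: "\<omega> \<in> S" by (simp add: S_def)
  have only: "omega s j = \<omega>" if "omega s j \<in> S" for j
  proof -
    have "k - 1 < j" "j < k + 1" using that height_omega_less_iff[OF cos] by (auto simp: S_def)
    then have "j = k" by simp
    then show ?thesis by (simp add: \<omega>_def)
  qed
  let ?p = "2 * of_real pi * \<i> :: complex"
  have NS: "t \<in> S" "t + ?p \<in> S" "t \<noteq> \<omega>" "t + ?p \<noteq> \<omega>" if "t \<in> N" for t
  proof -
    have "height \<theta> (omega s (k - 1)) = height \<theta> (omega s k) + 2 * pi * cos \<theta>"
      "height \<theta> (omega s (k + 1)) = height \<theta> (omega s k) - 2 * pi * cos \<theta>"
      by (simp_all add: height_omega algebra_simps)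
    moreover have "height \<theta> (t + ?p) = height \<theta> t + 2 * pi * cos \<theta>"
      by (simp add: height_add)
    moreover have "height \<theta> \<omega> < height \<theta> t" "height \<theta> t < height \<theta> (omega s (k + 1))"
      using that by (simp_all add: N_def \<omega>_def)
    ultimately have h: "height \<theta> (omega s (k - 1)) < height \<theta> t" "height \<theta> t < height \<theta> (omega s (k + 1))"
      "height \<theta> (omega s (k - 1)) < height \<theta> (t + ?p)" "height \<theta> (t + ?p) < height \<theta> \<omega>"
      "height \<theta> \<omega> < height \<theta> t"
      using hm unfolding \<omega>_def by linarith+
    from h(1,2) show "t \<in> S" by (simp only: S_def mem_Collect_eq)
    have "height \<theta> (t + ?p) < height \<theta> (omega s (k + 1))" using h(4) hm(2) by linarith
    with h(3) show "t + ?p \<in> S" by (simp only: S_def mem_Collect_eq)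
    show "t \<noteq> \<omega>" "t + ?p \<noteq> \<omega>" using h(4,5) by (metis less_irrefl)+
  qed
  define f where "f = (\<lambda>t. (exp (- z * t) - exp (- z * \<omega>)) * phi_hat s t)"
  have "phi_hat s analytic_on S - {\<omega>}"
    by (rule phi_hat_analytic) (use only in auto)
  then have "f holomorphic_on S - {\<omega>}"
    unfolding f_def by (intro holomorphic_intros analytic_imp_holomorphic)
  moreover have "\<omega> \<in> interior S" using \<omega>S S(1) by (simp add: interior_open)
  moreover have "((\<lambda>t. (t - \<omega>) * f t) \<longlongrightarrow> 0) (at \<omega>)"
  proof -
    have "((\<lambda>t. (exp (- z * t) - exp (- z * \<omega>)) * ((t - \<omega>) * phi_hat s t)) \<longlongrightarrow>
        (exp (- z * \<omega>) - exp (- z * \<omega>)) * 1) (at \<omega>)"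
      using phi_hat_residue[of s k] unfolding \<omega>_def[symmetric] by (intro tendsto_intros)
    then show ?thesis by (simp add: f_def mult_ac)
  qed
  ultimately obtain g where g: "g holomorphic_on S" "\<And>t. t \<in> S - {\<omega>} \<Longrightarrow> g t = f t"
    using holomorphic_on_extend_lim[of f S \<omega>] by blast
  obtain Q where Q': "\<And>t. t \<in> S \<Longrightarrow> (Q has_field_derivative g t) (at t within S)"
    using holomorphic_convex_primitive'[OF S(2,1) g(1)] by blast
  have Q: "(Q has_field_derivative g t) (at t)" if "t \<in> S" for t
    using Q'[OF that] by (simp only: at_within_open[OF that S(1)])
  have zn: "z \<notin> \<int>\<^sub>\<le>\<^sub>0" "1 - z \<notin> \<int>\<^sub>\<le>\<^sub>0"
    using z nonpos_Ints_Int[of z] nonpos_Ints_Int[of "1 - z"] Ints_diff[of 1 "1 - z"] by auto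
  let ?L = "\<lambda>t. exp ((1 - z) * t - s) * phiP (exp (t - s)) (1 - z)"
  let ?A = "\<lambda>t. exp (- z * t) * phiP (exp (s - t)) z"
  have "\<exists>C. \<forall>t \<in> S \<inter> {t. Re t < Re s}. Q t = - ?L t - exp (- z * \<omega>) * Ln (1 - exp (t - s)) + C"
  proof (rule primitives_differ_by_const[where f = Q and d = g and S = "S \<inter> {t. Re t < Re s}"
        and g = "\<lambda>t. - ?L t - exp (- z * \<omega>) * Ln (1 - exp (t - s))"])
    fix t assume t: "t \<in> S \<inter> {t. Re t < Re s}"
    then have "t \<noteq> \<omega>" by (auto simp: \<omega>_def)
    then have "g t = - (- (exp (- z * t) * phi_hat s t)) - exp (- z * \<omega>) * phi_hat s t"
      using g(2)[of t] t by (simp add: f_def algebra_simps)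
    then show "((\<lambda>t. - ?L t - exp (- z * \<omega>) * Ln (1 - exp (t - s))) has_field_derivative g t) (at t)"
      using DERIV_diff[OF DERIV_minus[OF laplace_primitive_left[OF zn(2)]]
          DERIV_cmult[OF phi_hat_primitive_left]] t by simp
  qed (use Q S in \<open>auto intro!: convex_Int convex_halfspace_Re_lt\<close>)
  then obtain C where C: "\<And>t. t \<in> S \<Longrightarrow> Re t < Re s \<Longrightarrow>
      Q t = - ?L t - exp (- z * \<omega>) * Ln (1 - exp (t - s)) + C" by blast
  have "\<exists>C. \<forall>t \<in> S \<inter> {t. Re s < Re t}. Q t = - ?A t - exp (- z * \<omega>) * (t + Ln (1 - exp (s - t))) + C"
  proof (rule primitives_differ_by_const[where f = Q and d = g and S = "S \<inter> {t. Re s < Re t}"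
        and g = "\<lambda>t. - ?A t - exp (- z * \<omega>) * (t + Ln (1 - exp (s - t)))"])
    fix t assume t: "t \<in> S \<inter> {t. Re s < Re t}"
    then have "t \<noteq> \<omega>" by (auto simp: \<omega>_def)
    then have "g t = - (- (exp (- z * t) * phi_hat s t)) - exp (- z * \<omega>) * phi_hat s t"
      using g(2)[of t] t by (simp add: f_def algebra_simps)
    then show "((\<lambda>t. - ?A t - exp (- z * \<omega>) * (t + Ln (1 - exp (s - t)))) has_field_derivative g t) (at t)"
      using DERIV_diff[OF DERIV_minus[OF laplace_primitive_right[OF zn(1)]]
          DERIV_cmult[OF phi_hat_primitive_right]] t by simp
  qed (use Q S in \<open>auto intro!: convex_Int convex_halfspace_Re_gt\<close>)
  then obtain C' where C': "\<And>t. t \<in> S \<Longrightarrow> Re s < Re t \<Longrightarrow>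
      Q t = - ?A t - exp (- z * \<omega>) * (t + Ln (1 - exp (s - t))) + C'" by blast
  \<comment> \<open>Under the translation the subtracted terms cancel and
    \<open>exp (- z * t)\<close> acquires the factor \<open>c\<close>; dividing by
    \<open>c - 1\<close> normalises the result.\<close>
  define P where "P = (\<lambda>t. (Q (t + ?p) - Q t) / (c - 1))"
  show ?thesis
  proof (rule that[of P])
    fix t assume t: "t \<in> N"
    have "((\<lambda>t. t + ?p) has_field_derivative 1) (at t)" by (auto intro!: derivative_eq_intros)
    from DERIV_chain2[OF Q[OF NS(2)[OF t]] this]
    have "((\<lambda>t. Q (t + ?p)) has_field_derivative g (t + ?p)) (at t)" by simp
    from DERIV_cdivide[OF DERIV_diff[OF this Q[OF NS(1)[OF t]]], of "c - 1"]
    have "(P has_field_derivative (g (t + ?p) - g t) / (c - 1)) (at t)"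
      by (simp add: P_def)
    moreover have "g (t + ?p) - g t = (c - 1) * (exp (- z * t) * phi_hat s t)"
    proof -
      have "g (t + ?p) = (c * exp (- z * t) - exp (- z * \<omega>)) * phi_hat s t"
        using g(2)[of "t + ?p"] NS[OF t] unfolding f_def phi_hat_add_2pi_i exp_mult_add_2pi_i c_def by simp
      moreover have "g t = (exp (- z * t) - exp (- z * \<omega>)) * phi_hat s t"
        using g(2)[of t] NS[OF t] unfolding f_def by simp
      ultimately have "g (t + ?p) - g t = (c * exp (- z * t) - exp (- z * \<omega>)) * phi_hat s t -
          (exp (- z * t) - exp (- z * \<omega>)) * phi_hat s t" by (simp only:)
      then show ?thesis by (simp only: left_diff_distrib mult.assoc) simp
    qed
    ultimately show "(P has_field_derivative exp (- z * t) * phi_hat s t) (at t)"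
      using c by simp
  next
    fix t assume t: "t \<in> N" and re: "Re t < Re s"
    have L: "?L (t + ?p) = c * ?L t"
    proof -
      have "(1 - z) * (t + ?p) - s = ((1 - z) * t - s + - 2 * of_real pi * \<i> * z) + ?p"
        by (simp add: algebra_simps)
      then have "exp ((1 - z) * (t + ?p) - s) = exp ((1 - z) * t - s + - 2 * of_real pi * \<i> * z)"
        by (simp only: exp_add_2pi_i)
      also have "\<dots> = c * exp ((1 - z) * t - s)"
        unfolding c_def exp_add by (rule mult.commute)
      finally have "exp ((1 - z) * (t + ?p) - s) = c * exp ((1 - z) * t - s)" .
      moreover have "exp (t + ?p - s) = exp (t - s)" by (simp add: exp_diff)
      ultimately show ?thesis by simp
    qed
    have "exp (t + ?p - s) = exp (t - s)" by (simp add: exp_diff)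
    \<comment> \<open>Translation preserves the real part, so both points lie on the left; the
      constant \<open>C\<close> and the periodic logarithm cancel.\<close>
    then have "Q (t + ?p) - Q t = - ?L (t + ?p) + ?L t"
      using C[of t] C[of "t + ?p"] NS[OF t] re by simp
    also have "\<dots> = (c - 1) * - ?L t" unfolding L by (simp add: algebra_simps)
    finally show "P t = - ?L t" using c by (simp add: P_def)
  next
    fix t assume t: "t \<in> N" and re: "Re s < Re t"
    have e: "exp (s - (t + ?p)) = exp (s - t)" by (simp add: exp_diff)
    have A: "?A (t + ?p) = c * ?A t"
      unfolding e exp_mult_add_2pi_i c_def by simp
    have "Q (t + ?p) = - ?A (t + ?p) - exp (- z * \<omega>) * (t + ?p + Ln (1 - exp (s - t))) + C'"
      using C'[OF NS(2)[OF t]] re unfolding e by simp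
    \<comment> \<open>On the right the logarithm cancels too, but the linear summand leaves
      \<open>?p\<close>, the residue term.\<close>
    then have "Q (t + ?p) - Q t = - ?A (t + ?p) + ?A t - exp (- z * \<omega>) * ?p"
      unfolding C'[OF NS(1)[OF t] re] by (simp only: distrib_left) simp
    also have "\<dots> = (c - 1) * - ?A t - exp (- z * \<omega>) * ?p" unfolding A by (simp add: algebra_simps)
    also have "\<dots> = (c - 1) * (- ?A t + ?p * (exp (- \<omega> * z) / (1 - c)))"
      using c by (simp add: field_simps)
    finally show "P t = - ?A t + 2 * of_real pi * \<i> * (exp (- omega s k * z) / (1 - exp (- 2 * of_real pi * \<i> * z)))"
      unfolding P_def using c by (simp add: \<omega>_def c_def)
  qed
qed

section \<open>The Borel sum in the directions between consecutive poles\<close>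

lemma has_integral_laplace_J:
  assumes s: "Re s < 0" and \<theta>: "\<theta> \<in> J s k" and z: "z \<notin> \<int>" "z \<in> half_plane \<theta> (cos \<theta>)"
  shows "((\<lambda>\<xi>. exp (- z * of_real \<xi> * cis \<theta>) * phi_hat s (of_real \<xi> * cis \<theta>) * cis \<theta>)
           has_integral phiP_cont s k z) {0..}"
proof -
  note cos = mem_J_bounds(3)[OF s \<theta>]
  let ?N = "\<lambda>t. height \<theta> (omega s k) < height \<theta> t \<and> height \<theta> t < height \<theta> (omega s (k + 1))"
  obtain P where P:
    "\<And>t. ?N t \<Longrightarrow> (P has_field_derivative exp (- z * t) * phi_hat s t) (at t)"
    "\<And>t. ?N t \<Longrightarrow> Re t < Re s \<Longrightarrow> P t = - (exp ((1 - z) * t - s) * phiP (exp (t - s)) (1 - z))"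
    "\<And>t. ?N t \<Longrightarrow> Re s < Re t \<Longrightarrow> P t = - (exp (- z * t) * phiP (exp (s - t)) z) +
        2 * of_real pi * \<i> * (exp (- omega s k * z) / (1 - exp (- 2 * of_real pi * \<i> * z)))"
    using laplace_primitive_J[OF s cos z(1), of k] by auto
  have N: "?N (of_real \<xi> * cis \<theta>)" for \<xi>
    using height_omega_J[OF s \<theta>] by simp
  have "1 - z \<notin> \<int>\<^sub>\<le>\<^sub>0"
    using z(1) nonpos_Ints_Int[of "1 - z"] Ints_diff[of 1 "1 - z"] by auto
  then obtain M where M: "\<And>v. norm v \<le> exp (- 1) \<Longrightarrow> norm (phiP v (1 - z)) \<le> M"
    using phiP_bounded[of "1 - z" "exp (- 1)"] by auto
  obtain B where B: "\<And>\<xi>. \<xi> \<ge> 0 \<Longrightarrow> norm (phi_hat s (of_real \<xi> * cis \<theta>)) \<le> B * exp (cos \<theta> * \<xi>)"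
    using phi_hat_bound_ray[OF s \<theta>] by blast
  define a where "a = Re ((z - 1) * cis \<theta>)"
  have "a > 0" using z(2) by (simp only: a_def mem_half_plane_cos_iff)
  have "((\<lambda>\<xi>. P (of_real \<xi> * cis \<theta>)) \<longlongrightarrow> 0) at_top"
  proof (rule Lim_null_comparison[OF _ tendsto_exp_minus_mult_at_top[OF \<open>a > 0\<close>, of "exp (- Re s) * M"]])
    show "\<forall>\<^sub>F \<xi> in at_top. norm (P (of_real \<xi> * cis \<theta>)) \<le> exp (- a * \<xi>) * (exp (- Re s) * M)"
      \<comment> \<open>Past this threshold \<open>Re t \<le> Re s - 1\<close>, so
        \<open>exp (t - s)\<close> stays in the disc of radius \<open>exp (- 1)\<close> on which
        \<open>M\<close> bounds the reflected series.\<close>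
      using eventually_ge_at_top[of "(Re s - 1) / cos \<theta>"]
    proof eventually_elim
      case (elim \<xi>)
      let ?t = "of_real \<xi> * cis \<theta>"
      have re: "Re ?t \<le> Re s - 1" using elim cos by (simp add: divide_simps mult.commute)
      then have "norm (phiP (exp (?t - s)) (1 - z)) \<le> M" by (intro M) simp
      moreover have "norm (exp ((1 - z) * ?t - s)) = exp (- a * \<xi>) * exp (- Re s)"
        by (simp add: a_def exp_add[symmetric] algebra_simps)
      moreover have "P ?t = - (exp ((1 - z) * ?t - s) * phiP (exp (?t - s)) (1 - z))"
        using P(2)[OF N, of \<xi>] re by simp
      ultimately show ?case
        by (simp only: norm_minus_cancel norm_mult mult.assoc) (intro mult_left_mono; simp)
    qed
  qed
  then have "((\<lambda>\<xi>. exp (- z * of_real \<xi> * cis \<theta>) * phi_hat s (of_real \<xi> * cis \<theta>) * cis \<theta>)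
      has_integral (0 - P 0)) {0..}"
    by (intro has_integral_laplace[OF P(1)[OF N] B z(2)])
  \<comment> \<open>The origin lies right of the line of poles, so the formula with the connection
    constant applies there.\<close>
  moreover have "P 0 = - phiP_cont s k z"
    using P(3)[of 0] N[of 0] s by (simp add: phiP_cont_def)
  ultimately show ?thesis by simp
qed

lemma phiP_cont_analytic:
  assumes s: "Re s < 0" and z: "z \<notin> \<int>"
  shows "phiP_cont s k analytic_on {z}"
proof -
  have "phiP (exp s) analytic_on {z}"
    using s z nonpos_Ints_Int[of z] by (intro phiP_analytic) auto
  then show ?thesis
    unfolding phiP_cont_def[abs_def] using z exp_minus_2pi_i_eq_1_iff[of z]
    by (intro analytic_intros) auto
qed

lemma phiP_cont_meromorphic:
  assumes "Re s < 0"
  shows "phiP_cont s k meromorphic_on A"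
proof -
  have "phiP (exp s) meromorphic_on A"
    using assms by (intro phiP_meromorphic) simp
  moreover have "(\<lambda>z. exp (- omega s k * z)) meromorphic_on A"
    "(\<lambda>z. exp (- 2 * of_real pi * \<i> * z)) meromorphic_on A"
    by (auto intro!: analytic_on_imp_meromorphic_on analytic_intros)
  ultimately show ?thesis
    unfolding phiP_cont_def[abs_def]
    by (intro meromorphic_on_diff meromorphic_on_mult meromorphic_on_divide meromorphic_on_const)
qed

text \<open>
  At an integer the Laplace integral is the limit of its values at nearby non-integers, by
  dominated convergence; so the singularities of \<open>phiP_cont\<close> in the half-plane are removable.
\<close>
lemma has_integral_laplace_J_remove_sings:
  assumes s: "Re s < 0" and \<theta>: "\<theta> \<in> J s k" and z: "z \<in> half_plane \<theta> (cos \<theta>)"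
  shows "((\<lambda>\<xi>. exp (- z * of_real \<xi> * cis \<theta>) * phi_hat s (of_real \<xi> * cis \<theta>) * cis \<theta>)
           has_integral remove_sings (phiP_cont s k) z) {0..}" (is "(?f z has_integral _) _")
    and "phiP_cont s k \<midarrow>z\<rightarrow> remove_sings (phiP_cont s k) z"
proof -
  obtain B where B: "\<And>\<xi>. \<xi> \<ge> 0 \<Longrightarrow> norm (phi_hat s (of_real \<xi> * cis \<theta>)) \<le> B * exp (cos \<theta> * \<xi>)"
    using phi_hat_bound_ray[OF s \<theta>] by blast
  \<comment> \<open>Half the decay rate at \<open>z\<close>, so that one majorant serves for all
    nearby points.\<close>
  define e where "e = Re ((z - 1) * cis \<theta>) / 2"
  have e: "e > 0" "2 * e = Re ((z - 1) * cis \<theta>)"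
    using z unfolding mem_half_plane_cos_iff by (simp_all only: e_def)
  \<comment> \<open>A neighbourhood of \<open>z\<close> in which \<open>z\<close> is the only
    possible integer, so the formula for non-integral arguments holds on
    \<open>V - {z}\<close>.\<close>
  define V where "V = {x. e < Re ((x - 1) * cis \<theta>)} \<inter> - (\<int> - {z})"
  have "open {x. e < Re ((x - 1) * cis \<theta>)}"
    by (intro open_Collect_less continuous_intros)
  moreover have "closed (\<int> - {z})" by (rule closed_subset_Ints) auto
  ultimately have V: "open V" unfolding V_def by (intro open_Int open_Compl)
  have zV: "z \<in> V" using e unfolding V_def by auto
  have bound: "norm (?f x \<xi>) \<le> B * exp (- e * \<xi>)" if "x \<in> V" "\<xi> \<ge> 0" for x \<xi>
  proof -
    have "Re (x * cis \<theta>) - cos \<theta> > e" using that(1) by (simp add: V_def algebra_simps)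
    then have "e * \<xi> \<le> (Re (x * cis \<theta>) - cos \<theta>) * \<xi>" using that(2) by (intro mult_right_mono) auto
    then have le: "exp (- Re (x * cis \<theta>) * \<xi>) * exp (cos \<theta> * \<xi>) \<le> exp (- e * \<xi>)"
      by (simp add: exp_add[symmetric] algebra_simps)
    have "B * exp (cos \<theta> * \<xi>) \<ge> 0" using B[OF that(2)] norm_ge_zero order_trans by blast
    then have "B \<ge> 0" by (simp add: zero_le_mult_iff)
    have "norm (?f x \<xi>) = exp (- Re (x * cis \<theta>) * \<xi>) * norm (phi_hat s (of_real \<xi> * cis \<theta>))"
      by (simp only: norm_mult norm_exp_mult_cis norm_cis mult_1_right)
    also have "\<dots> \<le> exp (- Re (x * cis \<theta>) * \<xi>) * (B * exp (cos \<theta> * \<xi>))"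
      using B[OF that(2)] by (rule mult_left_mono) simp
    also have "\<dots> = B * (exp (- Re (x * cis \<theta>) * \<xi>) * exp (cos \<theta> * \<xi>))" by simp
    also have "\<dots> \<le> B * exp (- e * \<xi>)" using le \<open>B \<ge> 0\<close> by (rule mult_left_mono)
    finally show ?thesis .
  qed
  have dom: "(\<lambda>\<xi>. B * exp (- e * \<xi>)) integrable_on {0..}"
    using integrable_on_cmult_left[OF integrable_on_exp_minus_to_infinity[OF e(1), of 0], of B] by simp
  have seq: "?f z integrable_on {0..} \<and> (\<lambda>n. phiP_cont s k (X n)) \<longlonglongrightarrow> integral {0..} (?f z)"
    if X: "\<And>n. X n \<in> V - {z}" "X \<longlonglongrightarrow> z" for X
  proof -
    have int: "(?f (X n) has_integral phiP_cont s k (X n)) {0..}" for n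
    proof (rule has_integral_laplace_J[OF s \<theta>])
      show "X n \<notin> \<int>" using X(1)[of n] by (auto simp: V_def)
      have "0 < Re ((X n - 1) * cis \<theta>)" using X(1)[of n] e(1) by (auto simp: V_def)
      then show "X n \<in> half_plane \<theta> (cos \<theta>)" by (simp only: mem_half_plane_cos_iff)
    qed
    have lim: "(\<lambda>n. ?f (X n) \<xi>) \<longlonglongrightarrow> ?f z \<xi>" for \<xi>
      by (intro tendsto_intros X(2))
    note dc = dominated_convergence[where f = "\<lambda>n. ?f (X n)" and S = "{0..}", OF _ dom _ lim]
    have 1: "?f (X n) integrable_on {0..}" for n using int by blast
    have 2: "norm (?f (X n) \<xi>) \<le> B * exp (- e * \<xi>)" if "\<xi> \<in> {0..}" for n \<xi>
      using bound[of "X n" \<xi>] X(1)[of n] that by auto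
    show ?thesis
      using dc[OF 1 2] unfolding integral_unique[OF int] by blast
  qed
  have lim: "phiP_cont s k \<midarrow>z\<rightarrow> integral {0..} (?f z)"
  proof -
    have "(phiP_cont s k \<longlongrightarrow> integral {0..} (?f z)) (at z within V)"
      unfolding tendsto_at_iff_sequentially o_def using seq by blast
    then show ?thesis by (simp only: at_within_open[OF zV V])
  qed
  then have rs: "remove_sings (phiP_cont s k) z = integral {0..} (?f z)" by (rule remove_sings_eqI)
  have "z islimpt V" using V zV by (simp add: interior_limit_point interior_open)
  then obtain X where "\<And>n. X n \<in> V - {z}" "X \<longlonglongrightarrow> z"
    unfolding islimpt_sequential by blast
  then have "?f z integrable_on {0..}" using seq by blast
  then show "(?f z has_integral remove_sings (phiP_cont s k) z) {0..}"
    unfolding rs by (rule integrable_integral)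
  show "phiP_cont s k \<midarrow>z\<rightarrow> remove_sings (phiP_cont s k) z"
    using lim unfolding rs .
qed

lemma borel_sum_phiP_J:
  assumes s: "Re s < 0" and z: "z \<in> borel_domain (J s k) cos"
  shows "borel_sum (J s k) cos (phiP_formal (exp s)) z = remove_sings (phiP_cont s k) z"
proof -
  note eqI = borel_sum_eqI[where a = "arg_omega s k" and b = "arg_omega s (k + 1)", folded J_def]
  show ?thesis
    by (rule eqI[OF arg_omega_less[OF s] J_length[OF s] phi_hat_analytic_extension_J[OF s] z])
      (rule has_integral_laplace_J_remove_sings(1)[OF s])
qed

lemma remove_sings_phiP_cont_analytic:
  assumes s: "Re s < 0" and z: "z \<in> borel_domain (J s k) cos"
  shows "remove_sings (phiP_cont s k) analytic_on {z}"
proof -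
  obtain \<theta> where "\<theta> \<in> J s k" "z \<in> half_plane \<theta> (cos \<theta>)"
    using z by (auto simp: borel_domain_def)
  then have "phiP_cont s k \<midarrow>z\<rightarrow> remove_sings (phiP_cont s k) z"
    using has_integral_laplace_J_remove_sings(2)[OF s] by blast
  then show ?thesis
    using phiP_cont_meromorphic[OF s, of k "{z}"]
    by (intro remove_sings_analytic_at meromorphic_on_isolated_singularity)
qed

section \<open>The difference equation and the second form of the connection term\<close>

text \<open>The connection term solves the homogeneous equation: its denominator has period 1, and
  \<open>exp (omega s k) = exp s\<close> balances the shift in its numerator.\<close>

lemma phiP_cont_equation:
  assumes s: "Re s < 0" and z: "z \<notin> \<int>"
  shows "phiP_cont s k z - exp s * phiP_cont s k (z + 1) = 1 / z"
proof -
  have "phiP (exp s) z = 1 / z + exp s * phiP (exp s) (z + 1)"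
    using s by (intro phiP_shift) simp
  moreover have "exp (- 2 * of_real pi * \<i> * (z + 1)) = exp (- 2 * of_real pi * \<i> * z)"
    using exp_add_2pi_i[of "- 2 * of_real pi * \<i> * (z + 1)"] by (simp add: algebra_simps)
  moreover have "exp s * exp (- omega s k * (z + 1)) = exp (- omega s k * z)"
  proof -
    have "- omega s k * (z + 1) = - omega s k * z - omega s k" by (simp add: algebra_simps)
    then show ?thesis by (simp add: exp_diff)
  qed
  ultimately show ?thesis
    unfolding phiP_cont_def right_diff_distrib mult.left_commute[of "exp s"] times_divide_eq_right
    by simp
qed

text \<open>Multiply numerator and denominator by \<open>exp (2 * of_real pi * \<i> * z)\<close>; in
  the numerator this raises the index of the pole by one.\<close>

lemma phiP_diff_phiP_cont_alt:
  assumes z: "z \<notin> \<int>"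
  shows "exp (- omega s k * z) / (1 - exp (- 2 * of_real pi * \<i> * z)) =
    - (exp (- omega s (k + 1) * z) / (1 - exp (2 * of_real pi * \<i> * z)))"
proof -
  define x where "x = exp (2 * of_real pi * \<i> * z)"
  have x: "x \<noteq> 1" "x \<noteq> 0" using z exp_2pi_i_eq_1_iff[of z] by (auto simp: x_def)
  have "exp (- omega s (k + 1) * z) = exp (- omega s k * z + 2 * of_real pi * \<i> * z)"
    unfolding omega_add_1 by (simp add: algebra_simps)
  then have 1: "exp (- omega s (k + 1) * z) = exp (- omega s k * z) * x"
    by (simp only: exp_add x_def)
  have 2: "exp (- 2 * of_real pi * \<i> * z) = 1 / x"
    by (simp add: x_def exp_minus inverse_eq_divide)
  have "a / (1 - 1 / x) = - (a * x / (1 - x))" for a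
    using x by (simp add: divide_simps) (simp add: algebra_simps)
  then show ?thesis unfolding 1 2 x_def[symmetric] .
qed

lemma remove_sings_phiP_cont_equation:
  assumes s: "Re s < 0" and z: "z \<in> borel_domain (J s k) cos" "z + 1 \<in> borel_domain (J s k) cos"
  shows "remove_sings (phiP_cont s k) z - exp s * remove_sings (phiP_cont s k) (z + 1) = 1 / z"
proof -
  let ?F = "remove_sings (phiP_cont s k)"
  \<comment> \<open>If \<open>z = 0\<close>, then \<open>z + 1\<close> would be the common boundary
    point 1 of all the half-planes.\<close>
  have "z \<noteq> 0"
    using z(2) by (auto simp: borel_domain_def mem_half_plane_cos_iff)
  have cont: "isCont ?F z" "isCont ?F (z + 1)"
    using remove_sings_phiP_cont_analytic[OF s] z by (auto intro: analytic_at_imp_isCont)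
  have "isCont (\<lambda>x. ?F (x + 1)) z"
    by (rule isCont_o2[where f = "\<lambda>x. x + 1"]) (use cont(2) in auto)
  with cont(1) have "isCont (\<lambda>x. ?F x - exp s * ?F (x + 1)) z"
    by (intro continuous_intros)
  then have 1: "(\<lambda>x. ?F x - exp s * ?F (x + 1)) \<midarrow>z\<rightarrow> ?F z - exp s * ?F (z + 1)"
    by (simp add: isCont_def)
  have "open (- (\<int> - {z}))" by (intro open_Compl closed_subset_Ints) auto
  then have "\<forall>\<^sub>F x in at z. x \<in> - (\<int> - {z}) - {z}"
    by (intro eventually_at_in_open) auto
  then have "\<forall>\<^sub>F x in at z. ?F x - exp s * ?F (x + 1) = 1 / x"
  proof eventually_elim
    case (elim x)
    then have x: "x \<notin> \<int>" "x + 1 \<notin> \<int>" using Ints_diff[of "x + 1" 1] by auto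
    then have "?F x = phiP_cont s k x" "?F (x + 1) = phiP_cont s k (x + 1)"
      using phiP_cont_analytic[OF s] by (auto intro: remove_sings_at_analytic)
    then show ?case using phiP_cont_equation[OF s x(1)] by simp
  qed
  then have "(\<lambda>x. 1 / x) \<midarrow>z\<rightarrow> ?F z - exp s * ?F (z + 1)"
    using 1 by (simp add: tendsto_cong)
  moreover have "(\<lambda>x. 1 / x) \<midarrow>z\<rightarrow> 1 / z"
    using \<open>z \<noteq> 0\<close> by (intro tendsto_intros)
  ultimately show ?thesis by (rule LIM_unique)
qed

theorem theorem12p3:
  fixes s w :: complex
  assumes "Re s < 0" and "w = exp s"
  shows
    "(\<lambda>\<zeta>. 1 / (1 - exp (s - \<zeta>))) has_fps_expansion formal_borel (phiP_formal w) \<and>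
     \<comment> \<open>part (1)\<close>
     (let I = {- pi / 2 <..< pi / 2} in
        one_summable I (phiP_formal w) \<and>
        fine_summable (pi / 2) (phiP_formal w) \<and>
        fine_summable (- pi / 2) (phiP_formal w) \<and>
        formal_borel (phiP_formal w) \<in>
          N_sector I (\<lambda>_. 0) \<inter> N_ray 0 (pi / 2) \<inter> N_ray 0 (- pi / 2) \<and>
        borel_domain I (\<lambda>_. 0) = UNIV - \<real>\<^sub>\<le>\<^sub>0 \<and>
        (\<forall>z\<in>borel_domain I (\<lambda>_. 0). borel_sum I (\<lambda>_. 0) (phiP_formal w) z = phiP w z)) \<and>
     \<comment> \<open>part (2)\<close>
     (\<forall>k::int.
        arg_omega s k < arg_omega s (k + 1) \<and>
        J s k \<subset> {pi / 2 <..< 3 * pi / 2} \<and>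
        one_summable (J s k) (phiP_formal w) \<and>
        formal_borel (phiP_formal w) \<in> N_sector (J s k) cos \<and>
        (let D = borel_domain (J s k) cos; S = borel_sum (J s k) cos (phiP_formal w) in
           sectorial_nbhd_infinity (arg_omega s k) (arg_omega s (k + 1)) D \<and>
           of_real ` {..<1} \<subseteq> D \<and>
           S holomorphic_on D \<and>
           (\<forall>z. z \<in> D \<longrightarrow> z + 1 \<in> D \<longrightarrow> S z - w * S (z + 1) = 1 / z) \<and>
           phiP w meromorphic_on UNIV \<and>
           \<comment> \<open>meromorphic continuation of the Borel sum; all poles involved lie in the integers\<close>
           (\<exists>F. F meromorphic_on UNIV \<and> (\<forall>z\<in>D. F z = S z) \<and>
              (\<forall>z. z \<notin> \<int> \<longrightarrow>
                 F z - w * F (z + 1) = 1 / z \<and>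
                 phiP w z - F z =
                   2 * of_real pi * \<i> * (exp (- omega s k * z) / (1 - exp (- 2 * of_real pi * \<i> * z))) \<and>
                 phiP w z - F z =
                   - 2 * of_real pi * \<i> * (exp (- omega s (k + 1) * z) / (1 - exp (2 * of_real pi * \<i> * z)))))))"
proof -
  note s = \<open>Re s < 0\<close> and w = \<open>w = exp s\<close>
  let ?I = "{- pi / 2<..<pi / 2}"
  have rays: "formal_borel (phiP_formal w) \<in> N_ray 0 (pi / 2)"
    "formal_borel (phiP_formal w) \<in> N_ray 0 (- pi / 2)"
    unfolding w by (rule phi_hat_N_ray[OF s]; simp)+
  have sector: "formal_borel (phiP_formal w) \<in> N_sector ?I (\<lambda>_. 0)"
    unfolding w by (rule phi_hat_N_sector_right[OF s])
  have part1: "one_summable ?I (phiP_formal w)" "fine_summable (pi / 2) (phiP_formal w)"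
    "fine_summable (- pi / 2) (phiP_formal w)"
    using rays sector locally_bounded_on_const[of ?I 0]
    unfolding one_summable_def fine_summable_def by (auto simp del: locally_bounded_on_const)
  have sum1: "borel_sum ?I (\<lambda>_. 0) (phiP_formal w) z = phiP w z" if "z \<in> borel_domain ?I (\<lambda>_. 0)" for z
    using that borel_sum_phiP_right[OF s, of z] unfolding w borel_domain_right_half_plane by blast
  have part2: "one_summable (J s k) (phiP_formal w)"
    "formal_borel (phiP_formal w) \<in> N_sector (J s k) cos" for k
    using phi_hat_N_sector_J[OF s, of k] unfolding one_summable_def w
    by (auto intro!: exI[of _ cos])
  let ?D = "\<lambda>k. borel_domain (J s k) cos"
  let ?S = "\<lambda>k. borel_sum (J s k) cos (phiP_formal w)"
  \<comment> \<open>Singularities are removed because every non-positive integer lies in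
    \<open>?D k\<close>, and agreement with the Borel sum is required there too.\<close>
  let ?F = "\<lambda>k. remove_sings (phiP_cont s k)"
  have S: "?S k z = ?F k z" if "z \<in> ?D k" for k z
    using borel_sum_phiP_J[OF s that] by (simp add: w)
  have "?F k holomorphic_on ?D k" for k
    using remove_sings_phiP_cont_analytic[OF s] analytic_on_analytic_at analytic_imp_holomorphic by blast
  then have hol: "?S k holomorphic_on ?D k" for k
    by (rule holomorphic_transform) (simp add: S)
  have eq: "?S k z - w * ?S k (z + 1) = 1 / z" if "z \<in> ?D k" "z + 1 \<in> ?D k" for k z
    using remove_sings_phiP_cont_equation[OF s that] S[OF that(1)] S[OF that(2)] w by simp
  have mero: "phiP w meromorphic_on UNIV"
    using s by (intro phiP_meromorphic) (simp add: w)
  have F: "?F k meromorphic_on UNIV" for k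
    by (intro remove_sings_meromorphic phiP_cont_meromorphic s)
  have Fz: "?F k z = phiP_cont s k z" if "z \<notin> \<int>" for k z
    by (intro remove_sings_at_analytic phiP_cont_analytic s that)
  have F1: "?F k z - w * ?F k (z + 1) = 1 / z" if "z \<notin> \<int>" for k z
  proof -
    have "z + 1 \<notin> \<int>" using that Ints_diff[of "z + 1" 1] by auto
    then show ?thesis using phiP_cont_equation[OF s that] by (simp add: Fz that w)
  qed
  have F2: "phiP w z - ?F k z =
      2 * of_real pi * \<i> * (exp (- omega s k * z) / (1 - exp (- 2 * of_real pi * \<i> * z)))"
    if "z \<notin> \<int>" for k z
    unfolding Fz[OF that] by (simp add: phiP_cont_def w)
  have F3: "phiP w z - ?F k z =
      - 2 * of_real pi * \<i> * (exp (- omega s (k + 1) * z) / (1 - exp (2 * of_real pi * \<i> * z)))"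
    if "z \<notin> \<int>" for k z
    unfolding F2[OF that] phiP_diff_phiP_cont_alt[OF that] by simp
  have nbhd: "sectorial_nbhd_infinity (arg_omega s k) (arg_omega s (k + 1)) (?D k)" for k
    unfolding J_def by (rule sectorial_nbhd_borel_domain_cos[OF arg_omega_less[OF s]])
  have expansion: "(\<lambda>\<zeta>. 1 / (1 - exp (s - \<zeta>))) has_fps_expansion formal_borel (phiP_formal w)"
    using phi_hat_has_fps_expansion[OF s] by (simp add: w phi_hat_def[abs_def])
  have cont: "\<exists>F. F meromorphic_on UNIV \<and> (\<forall>z\<in>?D k. F z = ?S k z) \<and>
      (\<forall>z. z \<notin> \<int> \<longrightarrow>
         F z - w * F (z + 1) = 1 / z \<and>
         phiP w z - F z =
           2 * of_real pi * \<i> * (exp (- omega s k * z) / (1 - exp (- 2 * of_real pi * \<i> * z))) \<and>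
         phiP w z - F z =
           - 2 * of_real pi * \<i> * (exp (- omega s (k + 1) * z) / (1 - exp (2 * of_real pi * \<i> * z))))" for k
  proof (rule exI[of _ "?F k"], intro conjI ballI allI impI)
    show "?F k z = ?S k z" if "z \<in> ?D k" for z by (rule S[OF that, symmetric])
  qed (rule F F1 F2 F3; assumption)+
  show ?thesis
    unfolding Let_def
    by (intro conjI allI ballI impI IntI)
      (rule expansion part1 sector rays borel_domain_right_half_plane sum1
        arg_omega_less[OF s] J_subset[OF s] part2 nbhd real_halfline_subset_borel_domain_J[OF s]
        hol eq mero cont; assumption)+
qed

end
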